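(* Let $u(x,t)$ be a weak solution of the system $u_t+f(u)_x=0$, $u,f(u)\in\mathbb{R}^D$, $x\in\mathbb{R}$, $t\ge 0$, with initial function $u(x,0)=u_0(x)$, $u_0\in L^1(\mathbb{R})\cap L^\infty(\mathbb{R})$. Assume that $u(x,t)$ satisfies the following properties: (a) $u(x,t)$ is locally bounded in $\mathbb{R}\times\overline{\mathbb{R}_+}$. (b) For every fixed interval $[x_1,x_2]\subseteq\mathbb{R}$ the mass $m(t)=\int_{x_1}^{x_2}u(x,t)\,dx$ is a well-defined and continuous function of $t\in\overline{\mathbb{R}_+}$. Then: (i) For every fixed $[t_1,t_2]\subseteq\overline{\mathbb{R}_+}$ the integral $g(x)=\int_{t_1}^{t_2}f(u(x,t))\,dt$ is locally Lipschitz continuous in $x\in\mathbb{R}$. (ii) In every rectangle $Q=[x_1,x_2]\times[t_1,t_2]\subseteq\mathbb{R}\times\overline{\mathbb{R}_+}$ the function $u(x,t)$ satisfies the equality $$\int_{x_1}^{x_2}u(x,t_2)\,dx-\int_{x_1}^{x_2}u(x,t_1)\,dx=-\Big[\int_{t_1}^{t_2}f(u(x_2,t))\,dt-\int_{t_1}^{t_2}f(u(x_1,t))\,dt\Big].$$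
   Context: Here $\overline{\mathbb{R}_+}=[0,\infty)$, $u(x,t)$ takes values in $\mathbb{R}^D$, and $f$ is the flux function, with values in $\mathbb{R}^D$. A function $u(x,t)$ is a weak solution of $u_t+f(u)_x=0$ if for every rectangle $Q=[x_1,x_2]\times[t_1,t_2]\subseteq\mathbb{R}\times\overline{\mathbb{R}_+}$ and every $\phi\in C_0^\infty(Q)$ (smooth, compactly supported in the interior of $Q$), $$\int_{t_1}^{t_2}\int_{x_1}^{x_2}\big[u(x,t)\phi_t(x,t)+f(u(x,t))\phi_x(x,t)\big]\,dx\,dt=0.$$
   Formalization: g(x) is the integral of f(u(x,t)) only for x outside a null set independent of t1, t2; a locally Lipschitz extension of it to all x satisfies (i) and (ii). For literal values the claim fails: f(v)=v, u=0 except u(0,t)=1. Integrability of u, f(u) on rectangles is explicit. *)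

theory Defs
  imports "HOL-Analysis.Analysis"
begin

text \<open>Iterated directional derivatives; on a Euclidean space \<open>C_k k\<close> is the usual class \<open>C\<^sup>k\<close>.\<close>

primrec C_k :: "nat \<Rightarrow> ('a::euclidean_space \<Rightarrow> 'b::real_normed_vector) \<Rightarrow> bool" where
  "C_k 0 g \<longleftrightarrow> continuous_on UNIV g"
| "C_k (Suc k) g \<longleftrightarrow>
     (\<forall>z. g differentiable (at z)) \<and> (\<forall>v. C_k k (\<lambda>z. frechet_derivative g (at z) v))"

definition smooth :: "('a::euclidean_space \<Rightarrow> 'b::real_normed_vector) \<Rightarrow> bool" where
  "smooth g \<longleftrightarrow> (\<forall>k. C_k k g)"

text \<open>\<open>C\<^sub>0\<^sup>\<infinity>(Q)\<close>: a test function on \<open>Q\<close> is extended by zero to the whole space.\<close>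

definition test_functions :: "'a::euclidean_space set \<Rightarrow> ('a \<Rightarrow> real) set" where
  "test_functions Q = {\<phi>. smooth \<phi> \<and> compact (closure {z. \<phi> z \<noteq> 0}) \<and>
                           closure {z. \<phi> z \<noteq> 0} \<subseteq> interior Q}"

text \<open>
  Points of the plane are pairs \<open>(x, t)\<close>; only the values \<open>u x t\<close> with \<open>t \<ge> 0\<close> are relevant.
  The first clause makes the integrals in the second well-defined. For continuous \<open>f\<close> it holds
  for every measurable, locally bounded \<open>u\<close>; in this form no regularity of \<open>f\<close> is needed.
\<close>

definition weak_solution ::
  "(real ^ 'd \<Rightarrow> real ^ 'd) \<Rightarrow> (real \<Rightarrow> real \<Rightarrow> real ^ 'd) \<Rightarrow> bool" where
  "weak_solution f u \<longleftrightarrow>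
     (\<forall>x1 x2 t1 t2. x1 \<le> x2 \<longrightarrow> 0 \<le> t1 \<longrightarrow> t1 \<le> t2 \<longrightarrow>
        (\<lambda>(x, t). u x t) absolutely_integrable_on ({x1..x2} \<times> {t1..t2}) \<and>
        (\<lambda>(x, t). f (u x t)) absolutely_integrable_on ({x1..x2} \<times> {t1..t2})) \<and>
     (\<forall>x1 x2 t1 t2. x1 \<le> x2 \<longrightarrow> 0 \<le> t1 \<longrightarrow> t1 \<le> t2 \<longrightarrow>
        (\<forall>\<phi> \<in> test_functions ({x1..x2} \<times> {t1..t2}).
           integral {t1..t2} (\<lambda>t. integral {x1..x2} (\<lambda>x.
               deriv (\<lambda>s. \<phi> (x, s)) t *\<^sub>R u x t + deriv (\<lambda>y. \<phi> (y, t)) x *\<^sub>R f (u x t))) = 0))"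

definition locally_bounded :: "(real \<Rightarrow> real \<Rightarrow> real ^ 'd) \<Rightarrow> bool" where
  "locally_bounded u \<longleftrightarrow>
     (\<forall>K. compact K \<and> K \<subseteq> UNIV \<times> {0..} \<longrightarrow> bounded ((\<lambda>(x, t). u x t) ` K))"

definition locally_lipschitz :: "(real \<Rightarrow> real ^ 'd) \<Rightarrow> bool" where
  "locally_lipschitz g \<longleftrightarrow> (\<forall>x. \<exists>e>0. \<exists>L. L-lipschitz_on (cball x e) g)"

end

theory Submission
  imports Defs
begin

text \<open>
  Test the equation with \<open>\<alpha>(x) \<beta>(t)\<close>, where \<open>\<alpha>\<close> and \<open>\<beta>\<close> are smooth approximations of trapezoids
  with ramps of width \<open>h\<close> over \<open>[a, b]\<close> and of width \<open>k\<close> over \<open>[s, r]\<close>. Dominated convergence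
  carries the weak identity over to the piecewise linear trapezoids themselves. As \<open>h \<rightarrow> 0\<close>,
  Lebesgue's differentiation theorem turns the flux term into the difference of the values at
  \<open>a\<close> and \<open>b\<close> of the \<open>\<beta>\<close>-weighted time integral of \<open>f(u)\<close>, for \<open>a\<close>, \<open>b\<close> outside a null set that
  depends only on \<open>\<beta>\<close>. Only countably many \<open>\<beta>\<close> are needed (rational \<open>s\<close>, \<open>r\<close> and \<open>k = 1 / (j + 1)\<close>),
  so one null set serves all of them. As \<open>k \<rightarrow> 0\<close>, continuity of the mass gives the balance law for
  rational times, and a further use of continuity extends it to all times. Off the null set the
  flux integral therefore differs by a constant from a primitive of the locally bounded function
  \<open>u(\<cdot>, t\<^sub>1) - u(\<cdot>, t\<^sub>2)\<close>; that primitive supplies the Lipschitz representative \<open>g\<close>.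
\<close>

section \<open>Fubini's theorem for absolutely integrable functions\<close>

text \<open>Each coordinate \<open>f x \<bullet> b\<close> has a Borel version; the finitely many
  null sets combine, and the versions reassemble along the basis. This reduces Lebesgue measurable
  integrands to Borel ones, for which Fubini's theorem on the product measure applies.\<close>

lemma borel_measurable_lebesgue_AE_eq_borel:
  fixes f :: "'a::euclidean_space \<Rightarrow> 'b::euclidean_space"
  assumes "f \<in> borel_measurable lebesgue"
  obtains g where "g \<in> borel_measurable lborel" "AE x in lborel. f x = g x"
proof -
  have "\<exists>g. g \<in> borel_measurable lborel \<and> (AE x in lborel. f x \<bullet> b = g x)" for b
    using completion_ex_borel_measurable_real[OF borel_measurable_inner[OF assms borel_measurable_const[of b]]]
    by blast
  then obtain g where "\<forall>b. g b \<in> borel_measurable lborel \<and> (AE x in lborel. f x \<bullet> b = g b x)"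
    using choice[of "\<lambda>b g. g \<in> borel_measurable lborel \<and> (AE x in lborel. f x \<bullet> b = g x)"] by blast
  then have g: "\<And>b. g b \<in> borel_measurable lborel"
      and eq: "\<And>b. AE x in lborel. f x \<bullet> b = g b x"
    by auto
  show thesis
  proof
    show "(\<lambda>x. \<Sum>b\<in>Basis. g b x *\<^sub>R b) \<in> borel_measurable lborel"
      by (intro borel_measurable_sum borel_measurable_scaleR g) auto
    have "AE x in lborel. \<forall>b\<in>Basis. f x \<bullet> b = g b x"
      using eq by (intro AE_finite_allI) auto
    then show "AE x in lborel. f x = (\<Sum>b\<in>Basis. g b x *\<^sub>R b)"
    proof eventually_elim
      case (elim x)
      have "f x = (\<Sum>b\<in>Basis. (f x \<bullet> b) *\<^sub>R b)"
        by (rule euclidean_representation[symmetric])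
      also have "\<dots> = (\<Sum>b\<in>Basis. g b x *\<^sub>R b)"
        by (rule sum.cong) (simp_all add: elim)
      finally show ?case .
    qed
  qed
qed

lemma integrable_lebesgue_cong_AE:
  fixes f g :: "'a::euclidean_space \<Rightarrow> 'b::euclidean_space"
  assumes "g \<in> borel_measurable lborel" "AE x in lborel. f x = g x"
  shows "integrable lebesgue f \<longleftrightarrow> integrable lborel g"
    and "integral\<^sup>L lebesgue f = integral\<^sup>L lborel g"
proof -
  have g: "g \<in> borel_measurable lebesgue"
    using assms(1) by (rule measurable_completion)
  have ae: "AE x in lebesgue. f x = g x"
    using assms(2) by (rule AE_completion)
  have f: "f \<in> borel_measurable lebesgue"
    by (rule borel_measurable_AE[OF g]) (use ae in auto)
  show "integrable lebesgue f \<longleftrightarrow> integrable lborel g"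
    using integrable_cong_AE[OF f g ae] integrable_completion[of g lborel] assms(1) by simp
  show "integral\<^sup>L lebesgue f = integral\<^sup>L lborel g"
    using integral_cong_AE[OF f g ae] integral_completion[of g lborel] assms(1) by simp
qed

text \<open>\<open>lebesgue\<close> on the product space is the completion of the product measure
  \<open>lborel \<Otimes>\<^sub>M lborel\<close>. Fubini's theorem is applied to a Borel version
  \<open>G\<close> and carried back: almost every section of \<open>F\<close> agrees almost
  everywhere with the same section of \<open>G\<close>.\<close>

lemma Fubini_lebesgue:
  fixes F :: "'a::euclidean_space \<times> 'b::euclidean_space \<Rightarrow> 'c::euclidean_space"
  assumes "integrable lebesgue F"
  shows "AE x in lebesgue. integrable lebesgue (\<lambda>y. F (x, y))"
    and "integrable lebesgue (\<lambda>x. \<integral>y. F (x, y) \<partial>lebesgue)"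
    and "(\<integral>x. (\<integral>y. F (x, y) \<partial>lebesgue) \<partial>lebesgue) = integral\<^sup>L lebesgue F"
proof -
  obtain G where G: "G \<in> borel_measurable lborel" and eq: "AE z in lborel. F z = G z"
    by (rule borel_measurable_lebesgue_AE_eq_borel[OF borel_measurable_integrable[OF assms]])
  have G2: "G \<in> borel_measurable (lborel \<Otimes>\<^sub>M lborel)"
    using G by (simp add: lborel_prod)
  have intG: "integrable lborel G" and FG: "integral\<^sup>L lebesgue F = integral\<^sup>L lborel G"
    using assms integrable_lebesgue_cong_AE[OF G eq] by auto
  have intG2: "integrable (lborel \<Otimes>\<^sub>M lborel) G"
    using intG by (simp add: lborel_prod)
  have "AE z in lborel \<Otimes>\<^sub>M lborel. F z = G z"
    unfolding lborel_prod by (rule eq)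
  then have "AE x in lborel. AE y in lborel. F (x, y) = G (x, y)"
    by (rule lborel_pair.AE_pair)
  then have sec: "AE x in lborel. (integrable lebesgue (\<lambda>y. F (x, y)) \<longleftrightarrow> integrable lborel (\<lambda>y. G (x, y)))
      \<and> (\<integral>y. F (x, y) \<partial>lebesgue) = (\<integral>y. G (x, y) \<partial>lborel)"
  proof eventually_elim
    case (elim x)
    have "(\<lambda>y. G (x, y)) \<in> borel_measurable lborel"
      using G2 by measurable
    from integrable_lebesgue_cong_AE[OF this elim] show ?case
      by simp
  qed
  have m: "(\<lambda>x. \<integral>y. G (x, y) \<partial>lborel) \<in> borel_measurable lborel"
    using lborel_pair.integrable_fst'[OF intG2] by auto
  have ae: "AE x in lborel. (\<integral>y. F (x, y) \<partial>lebesgue) = (\<integral>y. G (x, y) \<partial>lborel)"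
    using sec by eventually_elim auto
  show "AE x in lebesgue. integrable lebesgue (\<lambda>y. F (x, y))"
  proof (rule AE_completion)
    show "AE x in lborel. integrable lebesgue (\<lambda>y. F (x, y))"
      using sec lborel_pair.AE_integrable_fst'[OF intG2] by eventually_elim simp
  qed
  show "integrable lebesgue (\<lambda>x. \<integral>y. F (x, y) \<partial>lebesgue)"
    using integrable_lebesgue_cong_AE(1)[OF m ae] lborel_pair.integrable_fst'[OF intG2] by simp
  show "(\<integral>x. (\<integral>y. F (x, y) \<partial>lebesgue) \<partial>lebesgue) = integral\<^sup>L lebesgue F"
    using integrable_lebesgue_cong_AE(2)[OF m ae] lborel_pair.integral_fst'[OF intG2] FG
    by (simp add: lborel_prod)
qed

lemma Fubini_absolutely_integrable_on:
  fixes F :: "'a::euclidean_space \<times> 'b::euclidean_space \<Rightarrow> 'c::euclidean_space"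
  assumes "F absolutely_integrable_on (A \<times> B)"
  shows "negligible {x \<in> A. \<not> (\<lambda>y. F (x, y)) absolutely_integrable_on B}"
    and "(\<lambda>x. integral B (\<lambda>y. F (x, y))) absolutely_integrable_on A"
    and "integral A (\<lambda>x. integral B (\<lambda>y. F (x, y))) = integral (A \<times> B) F"
proof -
  define F' where "F' = (\<lambda>z. if z \<in> A \<times> B then F z else 0)"
  have F'_abs: "F' absolutely_integrable_on UNIV"
    unfolding F'_def using assms absolutely_integrable_restrict_UNIV by blast
  then have F': "integrable lebesgue F'"
    by (simp add: set_integrable_def)
  have sec: "(\<lambda>y. F' (x, y)) = (\<lambda>y. if y \<in> B then (if x \<in> A then F (x, y) else 0) else 0)" for x
    by (auto simp: F'_def)
  have sec_in: "integrable lebesgue (\<lambda>y. F' (x, y)) \<longleftrightarrow> (\<lambda>y. F (x, y)) absolutely_integrable_on B"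
    if "x \<in> A" for x
    unfolding sec using that absolutely_integrable_restrict_UNIV[of B "\<lambda>y. F (x, y)"]
    by (simp add: set_integrable_def cong: if_cong)
  obtain N where N: "N \<in> null_sets lebesgue" "{x. \<not> integrable lebesgue (\<lambda>y. F' (x, y))} \<subseteq> N"
    using Fubini_lebesgue(1)[OF F'] by (auto simp: eventually_ae_filter)
  show "negligible {x \<in> A. \<not> (\<lambda>y. F (x, y)) absolutely_integrable_on B}"
    by (rule negligible_subset[of N]) (use N sec_in in \<open>auto simp: negligible_iff_null_sets\<close>)
  define I where "I = (\<lambda>x. if x \<in> A then integral B (\<lambda>y. F (x, y)) else 0)"
  have "integral UNIV (\<lambda>y. F' (x, y)) = I x" for x
    unfolding sec integral_restrict_UNIV by (simp add: I_def)
  \<comment> \<open>Off \<open>N\<close> the section is Lebesgue integrable, so its Lebesgue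
    integral equals the gauge integral \<open>I x\<close>. On the null set \<open>N\<close> the two
    may differ.\<close>
  then have LI: "(\<integral>y. F' (x, y) \<partial>lebesgue) = I x" if "x \<notin> N" for x
    using that N(2) by (metis (mono_tags, lifting) integral_lebesgue mem_Collect_eq subsetD)
  have ae: "AE x in lebesgue. (\<integral>y. F' (x, y) \<partial>lebesgue) = I x"
    by (rule AE_I'[OF N(1)]) (use LI in auto)
  have m: "(\<lambda>x. \<integral>y. F' (x, y) \<partial>lebesgue) \<in> borel_measurable lebesgue"
    using Fubini_lebesgue(2)[OF F'] by auto
  have Im: "I \<in> borel_measurable lebesgue"
    by (rule borel_measurable_AE[OF m ae])
  have "integrable lebesgue I"
    using Fubini_lebesgue(2)[OF F'] integrable_cong_AE[OF m Im ae] by simp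
  then have Iabs: "I absolutely_integrable_on UNIV"
    by (simp add: set_integrable_def)
  then show "(\<lambda>x. integral B (\<lambda>y. F (x, y))) absolutely_integrable_on A"
    unfolding I_def using absolutely_integrable_restrict_UNIV by blast
  have "integral A (\<lambda>x. integral B (\<lambda>y. F (x, y))) = integral UNIV I"
    unfolding I_def by (rule integral_restrict_UNIV[symmetric])
  also have "\<dots> = integral\<^sup>L lebesgue I"
    using \<open>integrable lebesgue I\<close> by (simp add: integral_lebesgue)
  also have "\<dots> = integral\<^sup>L lebesgue F'"
    using integral_cong_AE[OF m Im ae] Fubini_lebesgue(3)[OF F'] by simp
  also have "\<dots> = integral UNIV F'"
    using F' by (simp add: integral_lebesgue)
  also have "\<dots> = integral (A \<times> B) F"
    unfolding F'_def by (rule integral_restrict_UNIV)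
  finally show "integral A (\<lambda>x. integral B (\<lambda>y. F (x, y))) = integral (A \<times> B) F" .
qed

text \<open>The weak formulation integrates over \<open>x\<close> inside and over \<open>t\<close>
  outside, while points are pairs \<open>(x, t)\<close>; exchanging the factors brings the double
  integral into that order.\<close>

lemma integrable_lebesgue_swap:
  fixes F :: "'a::euclidean_space \<times> 'b::euclidean_space \<Rightarrow> 'c::euclidean_space"
  assumes "integrable lebesgue F"
  shows "integrable lebesgue (\<lambda>(y, x). F (x, y))"
    and "integral\<^sup>L lebesgue (\<lambda>(y, x). F (x, y)) = integral\<^sup>L lebesgue F"
proof -
  obtain G where G: "G \<in> borel_measurable lborel" and eq: "AE z in lborel. F z = G z"
    by (rule borel_measurable_lebesgue_AE_eq_borel[OF borel_measurable_integrable[OF assms]])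
  have G2: "G \<in> borel_measurable (lborel \<Otimes>\<^sub>M lborel)"
    using G by (simp add: lborel_prod)
  have intG: "integrable lborel G" and FG: "integral\<^sup>L lebesgue F = integral\<^sup>L lborel G"
    using assms integrable_lebesgue_cong_AE[OF G eq] by auto
  have intG2: "integrable (lborel \<Otimes>\<^sub>M lborel) G"
    using intG by (simp add: lborel_prod)
  have "AE z in (lborel \<Otimes>\<^sub>M lborel). F z = G z"
    unfolding lborel_prod by (rule eq)
  \<comment> \<open>The exchange of factors preserves the product measure, so the null set where
    \<open>F\<close> and \<open>G\<close> differ stays null.\<close>
  then have "AE z in distr (lborel \<Otimes>\<^sub>M lborel) (lborel \<Otimes>\<^sub>M lborel) (\<lambda>(y, x). (x, y)). F z = G z"
    by (subst (asm) lborel_pair.distr_pair_swap)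
  then have "AE z in (lborel \<Otimes>\<^sub>M lborel). F (case z of (y, x) \<Rightarrow> (x, y)) = G (case z of (y, x) \<Rightarrow> (x, y))"
    by (intro AE_distrD[OF measurable_pair_swap']) auto
  then have eq': "AE z in lborel. (\<lambda>(y, x). F (x, y)) z = (\<lambda>(y, x). G (x, y)) z"
    unfolding lborel_prod by (simp add: case_prod_unfold)
  have "(\<lambda>(y, x). G (x, y)) \<in> borel_measurable (lborel \<Otimes>\<^sub>M lborel)"
    using G2 by measurable
  then have m: "(\<lambda>(y, x). G (x, y)) \<in> borel_measurable lborel"
    by (simp add: lborel_prod)
  show "integrable lebesgue (\<lambda>(y, x). F (x, y))"
    using integrable_lebesgue_cong_AE(1)[OF m eq'] lborel_pair.integrable_product_swap[OF intG2]
    by (simp add: lborel_prod)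
  show "integral\<^sup>L lebesgue (\<lambda>(y, x). F (x, y)) = integral\<^sup>L lebesgue F"
    using integrable_lebesgue_cong_AE(2)[OF m eq'] lborel_pair.integral_product_swap[OF G2] FG
    by (simp add: lborel_prod)
qed

lemma absolutely_integrable_on_swap:
  fixes F :: "'a::euclidean_space \<times> 'b::euclidean_space \<Rightarrow> 'c::euclidean_space"
  assumes "F absolutely_integrable_on (A \<times> B)"
  shows "(\<lambda>(y, x). F (x, y)) absolutely_integrable_on (B \<times> A)"
    and "integral (B \<times> A) (\<lambda>(y, x). F (x, y)) = integral (A \<times> B) F"
proof -
  define F' where "F' = (\<lambda>z. if z \<in> A \<times> B then F z else 0)"
  have "F' absolutely_integrable_on UNIV"
    unfolding F'_def using assms absolutely_integrable_restrict_UNIV by blast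
  then have F': "integrable lebesgue F'"
    by (simp add: set_integrable_def)
  have eq: "(\<lambda>(y, x). F' (x, y)) = (\<lambda>z. if z \<in> B \<times> A then (\<lambda>(y, x). F (x, y)) z else 0)"
    by (auto simp: F'_def)
  have abs: "(\<lambda>(y, x). F' (x, y)) absolutely_integrable_on UNIV"
    using integrable_lebesgue_swap(1)[OF F'] by (simp add: set_integrable_def)
  then show "(\<lambda>(y, x). F (x, y)) absolutely_integrable_on (B \<times> A)"
    unfolding eq absolutely_integrable_restrict_UNIV .
  have "integral (B \<times> A) (\<lambda>(y, x). F (x, y)) = integral UNIV (\<lambda>(y, x). F' (x, y))"
    unfolding eq by (rule integral_restrict_UNIV[symmetric])
  also have "\<dots> = integral\<^sup>L lebesgue (\<lambda>(y, x). F' (x, y))"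
    by (rule integral_lebesgue) (rule integrable_lebesgue_swap(1)[OF F'])
  also have "\<dots> = integral\<^sup>L lebesgue F'"
    by (rule integrable_lebesgue_swap(2)[OF F'])
  also have "\<dots> = integral UNIV F'"
    using F' by (simp add: integral_lebesgue)
  also have "\<dots> = integral (A \<times> B) F"
    unfolding F'_def by (rule integral_restrict_UNIV)
  finally show "integral (B \<times> A) (\<lambda>(y, x). F (x, y)) = integral (A \<times> B) F" .
qed

section \<open>Smooth trapezoids\<close>

lemma C_k_SucI:
  assumes "\<And>z. (g has_derivative D z) (at z)" "\<And>v. C_k k (\<lambda>z. D z v)"
  shows "C_k (Suc k) g"
proof -
  have "frechet_derivative g (at z) = D z" for z
    using assms(1) by (metis frechet_derivative_at)
  then show ?thesis
    using assms by (auto simp: differentiable_def)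
qed

text \<open>Differentiability gives continuity at the bottom level, and the induction passes to the
  directional derivatives. The product rule relies on this, since it leaves one factor
  undifferentiated.\<close>

lemma C_k_SucD: "C_k (Suc k) g \<Longrightarrow> C_k k g"
proof (induction k arbitrary: g)
  case 0
  then show ?case
    by (auto intro!: continuous_at_imp_continuous_on differentiable_imp_continuous_within)
next
  case (Suc k)
  from Suc.prems have diff: "\<And>z. g differentiable (at z)"
    and C: "\<And>v. C_k (Suc k) (\<lambda>z. frechet_derivative g (at z) v)"
    by (simp_all only: C_k.simps(2)[of "Suc k"])
  show ?case
    using diff Suc.IH[OF C] by (simp only: C_k.simps(2)) blast
qed

lemma C_k_const: "C_k k (\<lambda>z. c)"
proof (induction k arbitrary: c)
  case (Suc k)
  show ?case
    by (rule C_k_SucI[of _ "\<lambda>z v. 0"]) (auto intro: Suc)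
qed auto

lemma C_k_add:
  assumes "C_k k f" "C_k k g"
  shows "C_k k (\<lambda>z. f z + g z)"
  using assms
proof (induction k arbitrary: f g)
  case 0
  then show ?case by (auto intro: continuous_on_add)
next
  case (Suc k)
  have d: "\<And>z. (f has_derivative frechet_derivative f (at z)) (at z)"
    "\<And>z. (g has_derivative frechet_derivative g (at z)) (at z)"
    using Suc.prems by (auto simp: frechet_derivative_works)
  show ?case
    by (rule C_k_SucI[OF has_derivative_add[OF d]]) (use Suc in auto)
qed

text \<open>By the Leibniz rule a directional derivative is a sum of products of one factor with a
  derivative of the other, and all of these are in \<open>C_k k\<close>.\<close>

lemma C_k_mult:
  fixes f g :: "'a::euclidean_space \<Rightarrow> real"
  assumes "C_k k f" "C_k k g"
  shows "C_k k (\<lambda>z. f z * g z)"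
  using assms
proof (induction k arbitrary: f g)
  case 0
  then show ?case by (auto intro: continuous_on_mult)
next
  case (Suc k)
  have d: "\<And>z. (f has_derivative frechet_derivative f (at z)) (at z)"
    "\<And>z. (g has_derivative frechet_derivative g (at z)) (at z)"
    using Suc.prems by (auto simp: frechet_derivative_works)
  have "C_k k f" "C_k k g"
    using Suc.prems by (auto dest: C_k_SucD simp del: C_k.simps)
  then show ?case
    by (intro C_k_SucI[OF has_derivative_mult[OF d]] C_k_add Suc.IH) (use Suc.prems in auto)
qed

text \<open>The derivative in direction \<open>v\<close> is the derivative of \<open>g\<close> in
  the fixed direction \<open>L v\<close>, composed with the same affine map, so the induction
  hypothesis applies to it.\<close>

lemma C_k_compose_affine:
  fixes g :: "'b::euclidean_space \<Rightarrow> 'c::real_normed_vector" and L :: "'a::euclidean_space \<Rightarrow> 'b"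
  assumes "bounded_linear L" "C_k k g"
  shows "C_k k (\<lambda>z. g (L z + c))"
  using assms(2)
proof (induction k arbitrary: g)
  case 0
  have "continuous_on UNIV (\<lambda>z. L z + c)"
    using assms(1) by (intro continuous_on_add continuous_on_const linear_continuous_on)
  then show ?case
    using 0 by (auto intro: continuous_on_compose2[of UNIV g])
next
  case (Suc k)
  have dL: "((\<lambda>z. L z + c) has_derivative L) (at z)" for z
    using has_derivative_add[OF bounded_linear_imp_has_derivative[OF assms(1)] has_derivative_const[of c]]
    by simp
  have dg: "(g has_derivative frechet_derivative g (at w)) (at w)" for w
    using Suc.prems by (auto simp: frechet_derivative_works)
  show ?case
  proof (rule C_k_SucI)
    show "((\<lambda>z. g (L z + c)) has_derivative (\<lambda>v. frechet_derivative g (at (L z + c)) (L v))) (at z)" for z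
      using has_derivative_compose[OF dL dg] by simp
    show "C_k k (\<lambda>z. frechet_derivative g (at (L z + c)) (L v))" for v
      using Suc.IH[of "\<lambda>w. frechet_derivative g (at w) (L v)"] Suc.prems by simp
  qed
qed

lemma C_k_real_SucI:
  fixes A :: "real \<Rightarrow> real"
  assumes "\<And>x. (A has_real_derivative A' x) (at x)" "C_k k A'"
  shows "C_k (Suc k) A"
proof (rule C_k_SucI)
  show "(A has_derivative (\<lambda>v. A' x * v)) (at x)" for x
    using assms(1) by (simp add: has_field_derivative_def)
  show "C_k k (\<lambda>x. A' x * v)" for v
    by (rule C_k_mult[OF assms(2) C_k_const])
qed

lemma smooth_mult:
  fixes f g :: "'a::euclidean_space \<Rightarrow> real"
  shows "smooth f \<Longrightarrow> smooth g \<Longrightarrow> smooth (\<lambda>z. f z * g z)"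
  by (simp add: smooth_def C_k_mult)

lemma smooth_compose_affine:
  "smooth g \<Longrightarrow> bounded_linear L \<Longrightarrow> smooth (\<lambda>z. g (L z + c))"
  by (simp add: smooth_def C_k_compose_affine)

lemma smooth_antiderivative:
  fixes A :: "real \<Rightarrow> real"
  assumes "\<And>x. (A has_real_derivative A' x) (at x)" "smooth A'"
  shows "smooth A"
  unfolding smooth_def
proof
  show "C_k k A" for k
  proof (rule C_k_SucD)
    show "C_k (Suc k) A"
      using assms by (intro C_k_real_SucI) (auto simp: smooth_def)
  qed
qed

text \<open>
  Polynomials in \<open>1 / x\<close> times \<open>exp (- 1 / x)\<close>, extended by zero to \<open>x \<le> 0\<close>: the family is closed
  under differentiation, which makes all its members smooth.
\<close>

definition flat :: "real poly \<Rightarrow> real \<Rightarrow> real" where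
  "flat p x = (if x > 0 then poly p (1 / x) * exp (- (1 / x)) else 0)"

lemma poly_times_exp_uminus_tendsto_0: "((\<lambda>y::real. poly p y * exp (- y)) \<longlongrightarrow> 0) at_top"
proof -
  have "((\<lambda>y::real. \<Sum>i\<le>degree p. coeff p i * (y ^ i / exp y)) \<longlongrightarrow> (\<Sum>i\<le>degree p. coeff p i * 0)) at_top"
    by (intro tendsto_sum tendsto_mult tendsto_const tendsto_power_div_exp_0)
  then show ?thesis
    by (simp add: poly_altdef sum_distrib_right exp_minus divide_inverse mult.assoc)
qed

text \<open>For \<open>x > 0\<close> the derivative of \<open>p(1/x) exp(-1/x)\<close> is
  \<open>(1/x^2) (p - p')(1/x) exp(-1/x)\<close>, and the factor \<open>1/x^2\<close> is the
  polynomial \<open>[:0, 0, 1:]\<close> at \<open>1/x\<close>. At the origin the exponential decay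
  beats every polynomial.\<close>

lemma flat_has_real_derivative:
  "(flat p has_real_derivative flat ([:0, 0, 1:] * (p - pderiv p)) x) (at x)"
proof (cases x "0::real" rule: linorder_cases)
  case less
  have "(flat p has_real_derivative 0) (at x)"
    by (rule has_field_derivative_transform_within_open[of "\<lambda>_. 0" _ _ "{..<0}"])
      (use less in \<open>auto simp: flat_def\<close>)
  then show ?thesis
    using less by (simp add: flat_def)
next
  case greater
  have "((\<lambda>x. poly p (1 / x) * exp (- (1 / x))) has_real_derivative
          flat ([:0, 0, 1:] * (p - pderiv p)) x) (at x)"
    using greater
    by (auto intro!: derivative_eq_intros DERIV_chain2[OF poly_DERIV]
        simp: flat_def field_simps power2_eq_square)
  then show ?thesis
    by (rule has_field_derivative_transform_within_open[of _ _ _ "{0<..}"])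
      (use greater in \<open>auto simp: flat_def\<close>)
next
  case equal
  \<comment> \<open>With \<open>y = 1/h\<close>, dividing by \<open>h\<close> multiplies the
    polynomial by \<open>y\<close>, so the difference quotient is again a polynomial in
    \<open>y\<close> times \<open>exp (- y)\<close>.\<close>
  have "((\<lambda>h. poly ([:0, 1:] * p) (inverse h) * exp (- inverse h)) \<longlongrightarrow> 0) (at_right (0::real))"
    by (rule filterlim_compose[OF poly_times_exp_uminus_tendsto_0 filterlim_inverse_at_top_right])
  then have "((\<lambda>h. flat p h / h) \<longlongrightarrow> 0) (at_right 0)"
    by (rule Lim_transform_eventually)
      (auto simp: eventually_at_filter flat_def inverse_eq_divide intro!: always_eventually)
  moreover have "((\<lambda>h. flat p h / h) \<longlongrightarrow> 0) (at_left 0)"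
    by (rule Lim_transform_eventually[OF tendsto_const])
      (auto simp: eventually_at_filter flat_def intro!: always_eventually)
  ultimately have "((\<lambda>h. flat p h / h) \<longlongrightarrow> 0) (at 0)"
    by (simp add: filterlim_split_at)
  then show ?thesis
    using equal by (simp add: has_field_derivative_iff flat_def)
qed

lemma smooth_flat: "smooth (flat p)"
proof -
  have "C_k k (flat p)" for k
  proof (induction k arbitrary: p)
    case 0
    have "isCont (flat p) x" for x
      using DERIV_isCont flat_has_real_derivative by blast
    then show ?case
      by (simp add: continuous_at_imp_continuous_on)
  next
    case (Suc k)
    show ?case
      by (rule C_k_real_SucI[OF flat_has_real_derivative Suc])
  qed
  then show ?thesis
    by (simp add: smooth_def)
qed

text \<open>
  On \<open>(0, h)\<close> the product is \<open>exp (- (1 / x + 1 / (h - x)) / (n + 1))\<close>, which increases to \<open>1\<close>.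
\<close>

definition bump :: "nat \<Rightarrow> real \<Rightarrow> real \<Rightarrow> real" where
  "bump n h x = flat 1 (real (Suc n) * x) * flat 1 (real (Suc n) * (h - x))"

lemma flat_1_bounds: "0 \<le> flat 1 x" "flat 1 x \<le> 1"
  by (auto simp: flat_def)

lemma bump_bounds: "0 \<le> bump n h x" "bump n h x \<le> 1"
  unfolding bump_def by (simp_all add: flat_1_bounds mult_le_one)

lemma bump_eq_0: "x \<le> 0 \<or> h \<le> x \<Longrightarrow> bump n h x = 0"
  by (auto simp: bump_def flat_def zero_less_mult_iff)

lemma smooth_bump: "smooth (bump n h)"
proof -
  have "smooth (\<lambda>x. flat 1 (real (Suc n) * x + 0))" "smooth (\<lambda>x. flat 1 (- real (Suc n) * x + real (Suc n) * h))"
    by (intro smooth_compose_affine smooth_flat bounded_linear_mult_right)+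
  from smooth_mult[OF this] show ?thesis
    by (simp add: bump_def[abs_def] algebra_simps)
qed

text \<open>Inside the interval both factors tend to \<open>exp 0 = 1\<close>; elsewhere, endpoints
  included, one factor vanishes for every \<open>n\<close>.\<close>

lemma bump_tendsto: "(\<lambda>n. bump n h x) \<longlonglongrightarrow> indicator {0<..<h} x"
proof (cases "0 < x \<and> x < h")
  case True
  have lim: "(\<lambda>n. flat 1 (real (Suc n) * y)) \<longlonglongrightarrow> 1" if "y > 0" for y
  proof -
    have "(\<lambda>n. exp (- (inverse (real (Suc n)) * inverse y))) \<longlonglongrightarrow> exp (- (0 * inverse y))"
      by (intro tendsto_intros LIMSEQ_inverse_real_of_nat)
    then show ?thesis
      using that by (simp add: flat_def inverse_eq_divide del: of_nat_Suc)
  qed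
  have "(\<lambda>n. bump n h x) \<longlonglongrightarrow> 1 * 1"
    unfolding bump_def by (intro tendsto_mult lim) (use True in auto)
  then show ?thesis
    using True by simp
next
  case False
  then have "bump n h x = 0" for n
    by (intro bump_eq_0) auto
  then show ?thesis
    using False by simp
qed

text \<open>\<open>A\<close> is the primitive of the bump that vanishes at \<open>0\<close>:
  constant where the bump is zero, and of height at most \<open>h\<close> because the bump lies
  between \<open>0\<close> and \<open>1\<close>. The height \<open>A h\<close> is not normalised; it
  cancels in the difference of two translates.\<close>

lemma smooth_ramp:
  assumes "0 < h"
  obtains A where "smooth A" "\<And>x. (A has_real_derivative bump n h x) (at x)"
    "\<And>x. x \<le> 0 \<Longrightarrow> A x = 0" "\<And>x. h \<le> x \<Longrightarrow> A x = A h"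
    "\<And>x. 0 \<le> A x \<and> A x \<le> h" "\<And>x. 0 \<le> x \<Longrightarrow> (bump n h has_integral A x) {0..x}"
proof -
  have "isCont (bump n h) x" for x
    using DERIV_isCont smooth_bump[of n h] unfolding smooth_def
    by (metis C_k.simps(1) UNIV_I continuous_on_eq_continuous_at open_UNIV)
  then have "\<exists>F. \<forall>x::real. - \<infinity> < ereal x \<longrightarrow> ereal x < \<infinity> \<longrightarrow> (F has_vector_derivative bump n h x) (at x)"
    by (intro einterval_antiderivative) auto
  then obtain F where "\<And>x. (F has_vector_derivative bump n h x) (at x)"
    by auto
  then have F: "\<And>x. (F has_real_derivative bump n h x) (at x)"
    by (simp add: has_real_derivative_iff_has_vector_derivative)
  define A where "A = (\<lambda>x. F x - F 0)"
  have A: "(A has_real_derivative bump n h x) (at x)" for x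
    unfolding A_def using DERIV_diff[OF F DERIV_const] by simp
  have FTC: "(bump n h has_integral A y - A x) {x..y}" if "x \<le> y" for x y
    using that A
    by (intro fundamental_theorem_of_calculus)
      (auto simp: has_real_derivative_iff_has_vector_derivative intro: has_vector_derivative_at_within)
  have zero: "A x = A y" if "x \<le> y" "\<And>z. x \<le> z \<Longrightarrow> z \<le> y \<Longrightarrow> bump n h z = 0" for x y
  proof -
    have "(bump n h has_integral 0) {x..y}"
      by (rule has_integral_is_0) (use that in auto)
    then show ?thesis
      using has_integral_unique[OF _ FTC[OF that(1)]] by fastforce
  qed
  have mono: "A x \<le> A y" if "x \<le> y" for x y
    using has_integral_nonneg[OF FTC[OF that]] bump_bounds(1) by simp
  have A0: "A 0 = 0"
    by (simp add: A_def)
  have neg: "A x = 0" if "x \<le> 0" for x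
    using zero[OF that] A0 bump_eq_0 by simp
  have pos: "A x = A h" if "h \<le> x" for x
    using zero[OF that] bump_eq_0 by simp
  have "A h \<le> h"
    using has_integral_le[OF FTC[of 0 h] has_integral_const_real[of 1 0 h]] assms bump_bounds(2) A0 by simp
  then have bd: "0 \<le> A x \<and> A x \<le> h" for x
    using mono[of 0 x] mono[of x 0] mono[of x h] mono[of h x] neg[of x] pos[of x] A0 assms by linarith
  show thesis
  proof
    show "smooth A"
      by (rule smooth_antiderivative[OF A smooth_bump])
    show "(bump n h has_integral A x) {0..x}" if "0 \<le> x" for x
      using FTC[OF that] A0 by simp
  qed (fact A neg pos bd)+
qed

text \<open>
  \<open>trapezoid a b h\<close> rises linearly from \<open>0\<close> to \<open>1\<close> on \<open>[a, a + h]\<close> and falls back on \<open>[b, b + h]\<close>.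
\<close>

definition trapezoid :: "real \<Rightarrow> real \<Rightarrow> real \<Rightarrow> real \<Rightarrow> real" where
  "trapezoid a b h x = (max 0 (min h (x - a)) - max 0 (min h (x - b))) / h"

text \<open>The slope of the trapezoid away from its corners. The open intervals match the limit of
  the bumps at every point, so the later convergence needs no exceptional points.\<close>

definition trapezoid_deriv :: "real \<Rightarrow> real \<Rightarrow> real \<Rightarrow> real \<Rightarrow> real" where
  "trapezoid_deriv a b h x = (indicator {a<..<a + h} x - indicator {b<..<b + h} x) / h"

text \<open>For \<open>x > 0\<close> the ramp is the integral of the bump over
  \<open>[0, x]\<close>. By dominated convergence with majorant \<open>1\<close> it tends to the
  length of \<open>[0, h] \<inter> [0, x]\<close>.\<close>

lemma smooth_ramp_tendsto:
  assumes "0 < h"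
    and "\<And>n x. x \<le> 0 \<Longrightarrow> A n x = 0" "\<And>n x. 0 \<le> x \<Longrightarrow> (bump n h has_integral A n x) {0..x}"
  shows "(\<lambda>n. A n x) \<longlonglongrightarrow> max 0 (min h x)"
proof (cases "x \<le> 0")
  case True
  then show ?thesis
    using assms by simp
next
  case False
  then have int: "\<And>n. bump n h integrable_on {0..x}" and eq: "\<And>n. A n x = integral {0..x} (bump n h)"
    using assms(3)[of x] by (auto simp: has_integral_integrable intro: integral_unique[symmetric])
  have "(\<lambda>n. integral {0..x} (bump n h)) \<longlonglongrightarrow> integral {0..x} (indicator {0<..<h})"
    by (rule dominated_convergence[where h="\<lambda>_. 1"])
      (use int bump_bounds in \<open>auto simp: bump_tendsto\<close>)
  also have "integral {0..x} (indicator {0<..<h}) = integral {0..x} (indicator {0..h} :: real \<Rightarrow> real)"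
    by (rule integral_spike[of "{0, h}"]) (auto simp: indicator_def)
  also have "\<dots> = measure lebesgue ({0..h} \<inter> {0..x})"
    by (rule integral_indicator) (simp add: Int_atLeastAtMost)
  also have "\<dots> = max 0 (min h x)"
    using False assms(1) by (simp add: Int_atLeastAtMost)
  finally show ?thesis
    by (simp add: eq)
qed

text \<open>The difference of two shifted ramps, divided by \<open>h\<close>: to the right of
  \<open>b + h\<close> the plateaus cancel, which confines the support to \<open>[a, b + h]\<close>.
  The bounds are uniform in \<open>n\<close>, as dominated convergence requires.\<close>

lemma smooth_trapezoid_sequence:
  assumes "0 < h" "a \<le> b"
  obtains A A' where "\<And>n. smooth (A n)" "\<And>n x. (A n has_real_derivative A' n x) (at x)"
    "\<And>n. continuous_on UNIV (A' n)"
    "\<And>n x. x \<notin> {a..b + h} \<Longrightarrow> A n x = 0"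
    "\<And>n x. \<bar>A n x\<bar> \<le> 1" "\<And>n x. \<bar>A' n x\<bar> \<le> 1 / h"
    "\<And>x. (\<lambda>n. A n x) \<longlonglongrightarrow> trapezoid a b h x" "\<And>x. (\<lambda>n. A' n x) \<longlonglongrightarrow> trapezoid_deriv a b h x"
proof -
  \<comment> \<open>Collecting the properties in one predicate lets the axiom of choice select a
    ramp for every \<open>n\<close>.\<close>
  define P where "P = (\<lambda>n R. smooth R \<and> (\<forall>x. (R has_real_derivative bump n h x) (at x)) \<and>
    (\<forall>x\<le>0. R x = 0) \<and> (\<forall>x\<ge>h. R x = R h) \<and> (\<forall>x. 0 \<le> R x \<and> R x \<le> h) \<and>
    (\<forall>x\<ge>0. (bump n h has_integral R x) {0..x}))"
  have "\<exists>R. P n R" for n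
    by (rule smooth_ramp[OF assms(1), of n]) (unfold P_def, blast)
  then obtain R where PR: "\<And>n. P n (R n)"
    using choice[of P] by blast
  have R: "smooth (R n)" "(R n has_real_derivative bump n h x) (at x)"
    "x \<le> 0 \<Longrightarrow> R n x = 0" "h \<le> x \<Longrightarrow> R n x = R n h"
    "0 \<le> R n x \<and> R n x \<le> h" "0 \<le> x \<Longrightarrow> (bump n h has_integral R n x) {0..x}" for n x
    using PR[of n] unfolding P_def by blast+
  define A where "A = (\<lambda>n x. (R n (x - a) - R n (x - b)) / h)"
  define A' where "A' = (\<lambda>n x. (bump n h (x - a) - bump n h (x - b)) / h)"
  have smooth_A': "smooth (A' n)" for n
  proof -
    have "C_k k (\<lambda>x. (1 / h) * bump n h (x + - a) + (- 1 / h) * bump n h (x + - b))" for k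
      using smooth_bump[of n h] unfolding smooth_def
      by (intro C_k_add C_k_mult C_k_const C_k_compose_affine[of "\<lambda>x. x"] bounded_linear_ident) auto
    then show ?thesis
      by (simp add: smooth_def A'_def diff_divide_distrib)
  qed
  have der: "(A n has_real_derivative A' n x) (at x)" for n x
    unfolding A_def A'_def
    by (rule derivative_eq_intros DERIV_chain2[OF R(2)] refl | use assms(1) in simp)+
  show thesis
  proof
    show "smooth (A n)" for n
      by (rule smooth_antiderivative[OF der smooth_A'])
    show "continuous_on UNIV (A' n)" for n
      using smooth_A'[of n] unfolding smooth_def by (metis C_k.simps(1))
    show "A n x = 0" if "x \<notin> {a..b + h}" for n x
      using that assms R(3,4)[of "x - a" n] R(3,4)[of "x - b" n]
      by (auto simp: A_def not_le)
    show "\<bar>A n x\<bar> \<le> 1" for n x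
      using R(5)[of n "x - a"] R(5)[of n "x - b"] assms(1) by (auto simp: A_def abs_le_iff field_simps)
    show "\<bar>A' n x\<bar> \<le> 1 / h" for n x
      using bump_bounds[of n h "x - a"] bump_bounds[of n h "x - b"] assms(1)
      by (auto simp: A'_def abs_le_iff field_simps)
    show "(\<lambda>n. A n x) \<longlonglongrightarrow> trapezoid a b h x" for x
      unfolding A_def trapezoid_def using assms(1)
      by (intro tendsto_divide tendsto_diff tendsto_const smooth_ramp_tendsto R) auto
    have ind: "indicator {0<..<h} (x - c) = (indicator {c<..<c + h} x :: real)" for x c
      by (auto simp: indicator_def)
    show "(\<lambda>n. A' n x) \<longlonglongrightarrow> trapezoid_deriv a b h x" for x
      unfolding A'_def trapezoid_deriv_def using assms(1) bump_tendsto[of h "x - a"] bump_tendsto[of h "x - b"]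
      by (intro tendsto_divide tendsto_diff tendsto_const) (auto simp: ind)
  qed (fact der)
qed

text \<open>The support lies in \<open>[a, a'] \<times> [b, b']\<close>, and the strict inequalities
  place this closed rectangle in the interior of the large one. In particular the support must begin
  strictly after the initial time of the rectangle.\<close>

lemma tensor_test_function:
  fixes A B :: "real \<Rightarrow> real"
  assumes "smooth A" "smooth B"
    and "\<And>x. x \<notin> {a..a'} \<Longrightarrow> A x = 0" "\<And>t. t \<notin> {b..b'} \<Longrightarrow> B t = 0"
    and "x1 < a" "a' < x2" "t1 < b" "b' < t2"
  shows "(\<lambda>(x, t). A x * B t) \<in> test_functions ({x1..x2} \<times> {t1..t2})"
proof -
  have "smooth (\<lambda>z. A (fst z + 0) * B (snd z + 0))"
    by (intro smooth_mult smooth_compose_affine bounded_linear_fst bounded_linear_snd assms)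
  moreover have "{z. (\<lambda>(x, t). A x * B t) z \<noteq> 0} \<subseteq> {a..a'} \<times> {b..b'}"
    using assms(3,4) by force
  then have cl: "closure {z. (\<lambda>(x, t). A x * B t) z \<noteq> 0} \<subseteq> {a..a'} \<times> {b..b'}"
    by (intro closure_minimal closed_Times closed_atLeastAtMost)
  moreover have "compact (closure {z. (\<lambda>(x, t). A x * B t) z \<noteq> 0})"
    by (auto simp: compact_eq_bounded_closed intro!: bounded_subset[OF _ cl] bounded_Times)
  moreover have "{a..a'} \<times> {b..b'} \<subseteq> interior ({x1..x2} \<times> {t1..t2})"
    using assms(5-) by (auto simp: interior_Times)
  ultimately show ?thesis
    by (auto simp: test_functions_def case_prod_unfold)
qed

section \<open>Limits in the weak formulation\<close>

lemma absolutely_integrable_scaleR_bounded: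
  fixes g :: "'a::euclidean_space \<Rightarrow> 'b::euclidean_space" and f :: "'a \<Rightarrow> real"
  assumes "f \<in> borel_measurable borel" "\<And>z. \<bar>f z\<bar> \<le> C"
    and "S \<in> sets lebesgue" "g absolutely_integrable_on S"
  shows "(\<lambda>z. f z *\<^sub>R g z) absolutely_integrable_on S"
proof (rule absolutely_integrable_bounded_measurable_product[of "(*\<^sub>R)", OF _ _ assms(3) _ assms(4)])
  show "bilinear ((*\<^sub>R) :: real \<Rightarrow> 'b \<Rightarrow> 'b)"
    using bounded_bilinear_scaleR bilinear_conv_bounded_bilinear by blast
  have "f \<in> borel_measurable lebesgue"
    by (rule measurable_completion) (simp add: assms(1))
  then show "f \<in> borel_measurable (lebesgue_on S)"
    by (rule measurable_restrict_space1)
  show "bounded (f ` S)"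
    using assms(2) by (auto simp: bounded_iff)
qed

text \<open>The majorant is \<open>C * norm (g z)\<close>: uniformly bounded weights converging
  pointwise may be exchanged with the integral against any absolutely integrable
  \<open>g\<close>.\<close>

lemma scaleR_dominated_convergence:
  fixes g :: "'a::euclidean_space \<Rightarrow> 'b::euclidean_space" and f :: "nat \<Rightarrow> 'a \<Rightarrow> real"
  assumes "\<And>n. f n \<in> borel_measurable borel" "\<And>n z. \<bar>f n z\<bar> \<le> C"
    and "\<And>z. (\<lambda>n. f n z) \<longlonglongrightarrow> f0 z"
    and "S \<in> sets lebesgue" "g absolutely_integrable_on S"
  shows "(\<lambda>n. integral S (\<lambda>z. f n z *\<^sub>R g z)) \<longlonglongrightarrow> integral S (\<lambda>z. f0 z *\<^sub>R g z)"
proof (rule dominated_convergence(2)[where h="\<lambda>z. C * norm (g z)"])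
  show "(\<lambda>z. f n z *\<^sub>R g z) integrable_on S" for n
    using absolutely_integrable_scaleR_bounded[OF assms(1,2,4,5)]
    by (simp add: absolutely_integrable_on_def)
  show "(\<lambda>z. C * norm (g z)) integrable_on S"
    using assms(5) by (intro integrable_on_mult_right) (simp add: absolutely_integrable_on_def)
  show "norm (f n z *\<^sub>R g z) \<le> C * norm (g z)" for n z
    using assms(2)[of n z] by (simp add: mult_right_mono)
  show "(\<lambda>n. f n z *\<^sub>R g z) \<longlonglongrightarrow> f0 z *\<^sub>R g z" for z
    by (rule tendsto_scaleR[OF assms(3) tendsto_const])
qed

lemma trapezoid_borel: "trapezoid a b h \<in> borel_measurable borel"
  unfolding trapezoid_def[abs_def] divide_inverse
  by (intro borel_measurable_continuous_onI continuous_intros)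

lemma trapezoid_deriv_borel: "trapezoid_deriv a b h \<in> borel_measurable borel"
  unfolding trapezoid_deriv_def[abs_def] by measurable

lemma trapezoid_bound: "0 < h \<Longrightarrow> \<bar>trapezoid a b h x\<bar> \<le> 1"
proof -
  assume h: "0 < h"
  have *: "0 \<le> max 0 (min h y) \<and> max 0 (min h y) \<le> h" for y
    using h by (simp add: max_def min_def)
  have "\<bar>max 0 (min h (x - a)) - max 0 (min h (x - b))\<bar> \<le> h"
    using *[of "x - a"] *[of "x - b"] by arith
  then show "\<bar>trapezoid a b h x\<bar> \<le> 1"
    using h by (simp add: trapezoid_def abs_divide)
qed

lemma trapezoid_deriv_bound: "0 < h \<Longrightarrow> \<bar>trapezoid_deriv a b h x\<bar> \<le> 1 / h"
proof -
  assume h: "0 < h"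
  have "\<bar>indicator {a<..<a + h} x - indicator {b<..<b + h} x\<bar> \<le> (1::real)"
    by (simp split: split_indicator)
  then show "\<bar>trapezoid_deriv a b h x\<bar> \<le> 1 / h"
    unfolding trapezoid_deriv_def abs_divide using h by (simp add: divide_right_mono)
qed

lemma tensor_borel:
  fixes A B :: "real \<Rightarrow> real"
  assumes "A \<in> borel_measurable borel" "B \<in> borel_measurable borel"
  shows "(\<lambda>z. A (fst z) * B (snd z)) \<in> borel_measurable borel"
  unfolding borel_prod[symmetric] using assms by measurable

lemma tensor_bound:
  fixes A B :: "real \<Rightarrow> real"
  assumes "\<And>x. \<bar>A x\<bar> \<le> c" "\<And>t. \<bar>B t\<bar> \<le> d"
  shows "\<bar>A (fst z) * B (snd z)\<bar> \<le> c * d"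
  unfolding abs_mult by (intro mult_mono assms) (use assms(1)[of 0] in auto)

lemma rectangle_lebesgue: "{x1..x2::real} \<times> {t1..t2::real} \<in> sets lebesgue"
  using fmeasurableD[OF lmeasurable_cbox[of "(x1, t1)" "(x2, t2)"]] by (simp add: cbox_Pair_eq)

text \<open>The products \<open>A n x * B n t\<close> are test functions. Their derivatives are
  bounded uniformly in \<open>n\<close> by \<open>1 / k\<close> and \<open>1 / h\<close> and
  converge at every point, so the weak identity survives the limit although the limiting derivatives
  jump.\<close>

lemma weak_solution_trapezoid:
  fixes f :: "real ^ 'd \<Rightarrow> real ^ 'd"
  assumes weak: "weak_solution f u"
    and x: "x1 < a" "a \<le> b" "b + h < x2" "0 < h"
    and t: "0 \<le> t1" "t1 < s" "s \<le> r" "r + k < t2" "0 < k"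
  shows "integral ({x1..x2} \<times> {t1..t2}) (\<lambda>z. (trapezoid a b h (fst z) * trapezoid_deriv s r k (snd z)) *\<^sub>R u (fst z) (snd z))
    + integral ({x1..x2} \<times> {t1..t2}) (\<lambda>z. (trapezoid_deriv a b h (fst z) * trapezoid s r k (snd z)) *\<^sub>R f (u (fst z) (snd z))) = 0"
proof -
  let ?Q = "{x1..x2} \<times> {t1..t2}"
  obtain A A' where A: "\<And>n. smooth (A n)" "\<And>n x. (A n has_real_derivative A' n x) (at x)"
    "\<And>n. continuous_on UNIV (A' n)"
    "\<And>n x. x \<notin> {a..b + h} \<Longrightarrow> A n x = 0"
    "\<And>n x. \<bar>A n x\<bar> \<le> 1" "\<And>n x. \<bar>A' n x\<bar> \<le> 1 / h"
    "\<And>x. (\<lambda>n. A n x) \<longlonglongrightarrow> trapezoid a b h x" "\<And>x. (\<lambda>n. A' n x) \<longlonglongrightarrow> trapezoid_deriv a b h x"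
    by (rule smooth_trapezoid_sequence[OF x(4,2)]) blast
  obtain B B' where B: "\<And>n. smooth (B n)" "\<And>n x. (B n has_real_derivative B' n x) (at x)"
    "\<And>n. continuous_on UNIV (B' n)"
    "\<And>n x. x \<notin> {s..r + k} \<Longrightarrow> B n x = 0"
    "\<And>n x. \<bar>B n x\<bar> \<le> 1" "\<And>n x. \<bar>B' n x\<bar> \<le> 1 / k"
    "\<And>x. (\<lambda>n. B n x) \<longlonglongrightarrow> trapezoid s r k x" "\<And>x. (\<lambda>n. B' n x) \<longlonglongrightarrow> trapezoid_deriv s r k x"
    by (rule smooth_trapezoid_sequence[OF t(5,3)]) blast
  have "isCont (A n) x" "isCont (B n) x" for n x
    using DERIV_isCont A(2) B(2) by blast+
  then have borel: "A n \<in> borel_measurable borel" "A' n \<in> borel_measurable borel"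
    "B n \<in> borel_measurable borel" "B' n \<in> borel_measurable borel" for n
    by (simp_all add: borel_measurable_continuous_onI continuous_at_imp_continuous_on A(3) B(3))
  let ?AB' = "\<lambda>n z. A n (fst z) * B' n (snd z)" and ?A'B = "\<lambda>n z. A' n (fst z) * B n (snd z)"
  have AB'_borel: "?AB' n \<in> borel_measurable borel" and A'B_borel: "?A'B n \<in> borel_measurable borel" for n
    by (intro tensor_borel borel)+
  have AB'_bound: "\<bar>?AB' n z\<bar> \<le> 1 * (1 / k)" and A'B_bound: "\<bar>?A'B n z\<bar> \<le> 1 / h * 1" for n z
    by (intro tensor_bound A B)+
  have u: "(\<lambda>z. u (fst z) (snd z)) absolutely_integrable_on ?Q"
    and fu: "(\<lambda>z. f (u (fst z) (snd z))) absolutely_integrable_on ?Q"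
    using weak x t by (auto simp: weak_solution_def case_prod_unfold)
  define U where "U = (\<lambda>n z. (A n (fst z) * B' n (snd z)) *\<^sub>R u (fst z) (snd z))"
  define V where "V = (\<lambda>n z. (A' n (fst z) * B n (snd z)) *\<^sub>R f (u (fst z) (snd z)))"
  have U: "U n absolutely_integrable_on ?Q" for n
    unfolding U_def
    by (rule absolutely_integrable_scaleR_bounded[where f="?AB' n", OF AB'_borel AB'_bound rectangle_lebesgue u])
  have V: "V n absolutely_integrable_on ?Q" for n
    unfolding V_def
    by (rule absolutely_integrable_scaleR_bounded[where f="?A'B n", OF A'B_borel A'B_bound rectangle_lebesgue fu])
  have zero: "integral ?Q (U n) + integral ?Q (V n) = 0" for n
  proof -
    have test: "(\<lambda>(x, t). A n x * B n t) \<in> test_functions ?Q"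
      by (rule tensor_test_function[OF A(1) B(1) A(4) B(4)]) (use x t in auto)
    have dt: "deriv (\<lambda>s. A n x * B n s) t = A n x * B' n t" for x t
      by (intro DERIV_imp_deriv DERIV_cmult B)
    have dx: "deriv (\<lambda>y. A n y * B n t) x = A' n x * B n t" for x t
      by (intro DERIV_imp_deriv DERIV_cmult_right A)
    have "x1 \<le> x2" "t1 \<le> t2"
      using x t by auto
    from conjunct2[OF weak[unfolded weak_solution_def], rule_format, OF this(1) t(1) this(2) test]
    have weak0: "integral {t1..t2} (\<lambda>t. integral {x1..x2} (\<lambda>x. U n (x, t) + V n (x, t))) = 0"
      by (simp add: U_def V_def dt dx)
    \<comment> \<open>Absolute integrability on the rectangle lets Fubini's theorem, after the
      exchange of factors, identify the double integral with the iterated one of the weak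
      formulation.\<close>
    have UV: "(\<lambda>z. U n z + V n z) absolutely_integrable_on ?Q"
      by (intro set_integral_add U V)
    have "integral ?Q (U n) + integral ?Q (V n) = integral ?Q (\<lambda>z. U n z + V n z)"
      by (rule integral_add[symmetric]) (use U V in \<open>auto intro: set_lebesgue_integral_eq_integral(1)\<close>)
    also have "\<dots> = integral ({t1..t2} \<times> {x1..x2}) (\<lambda>(t, x). U n (x, t) + V n (x, t))"
      by (rule absolutely_integrable_on_swap(2)[OF UV, symmetric])
    also have "\<dots> = 0"
      using Fubini_absolutely_integrable_on(3)[OF absolutely_integrable_on_swap(1)[OF UV]] weak0 by simp
    finally show ?thesis .
  qed
  have "(\<lambda>n. integral ?Q (U n) + integral ?Q (V n)) \<longlonglongrightarrow>
    integral ?Q (\<lambda>z. (trapezoid a b h (fst z) * trapezoid_deriv s r k (snd z)) *\<^sub>R u (fst z) (snd z))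
    + integral ?Q (\<lambda>z. (trapezoid_deriv a b h (fst z) * trapezoid s r k (snd z)) *\<^sub>R f (u (fst z) (snd z)))"
    unfolding U_def V_def
    by (intro tendsto_add tendsto_mult A B
        scaleR_dominated_convergence[where f="?AB'", OF AB'_borel AB'_bound _ rectangle_lebesgue u]
        scaleR_dominated_convergence[where f="?A'B", OF A'B_borel A'B_bound _ rectangle_lebesgue fu])
  then show ?thesis
    unfolding zero by (rule LIMSEQ_unique[OF tendsto_const, symmetric])
qed

section \<open>Letting the spatial ramps shrink\<close>

lemma trapezoid_tendsto:
  assumes "a \<le> b" "\<And>j. 0 < h j" "h \<longlonglongrightarrow> 0"
  shows "(\<lambda>j. trapezoid a b (h j) x) \<longlonglongrightarrow> indicator {a<..b} x"
proof -
  \<comment> \<open>Once \<open>h j < x - c\<close> the ramp has reached its full height, while at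
    \<open>x \<le> c\<close> it is zero for every \<open>j\<close>. This is why the limit contains
    \<open>b\<close> but not \<open>a\<close>.\<close>
  have ramp: "(\<lambda>j. max 0 (min (h j) (x - c)) / h j) \<longlonglongrightarrow> indicator {c<..} x" for c
  proof (cases "c < x")
    case True
    have "eventually (\<lambda>j. h j < x - c) sequentially"
      using assms(3) True by (intro order_tendstoD(2)) auto
    then have "eventually (\<lambda>j. 1 = max 0 (min (h j) (x - c)) / h j) sequentially"
    proof eventually_elim
      case (elim j)
      then show ?case using assms(2)[of j] by simp
    qed
    then show ?thesis
      using True by (intro Lim_transform_eventually[OF tendsto_const]) simp_all
  next
    case False
    then have "max 0 (min (h j) (x - c)) = 0" for j
      by simp
    then show ?thesis
      using False by simp
  qed
  have "(\<lambda>j. trapezoid a b (h j) x) \<longlonglongrightarrow> indicator {a<..} x - indicator {b<..} x"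
    unfolding trapezoid_def diff_divide_distrib by (intro tendsto_diff ramp)
  moreover have "indicator {a<..} x - indicator {b<..} x = (indicator {a<..b} x :: real)"
    using assms(1) by (auto simp: indicator_def)
  ultimately show ?thesis
    by simp
qed

lemma integral_indicator_scaleR:
  fixes g :: "'a::euclidean_space \<Rightarrow> 'b::banach"
  assumes "A \<subseteq> S"
  shows "integral S (\<lambda>x. indicator A x *\<^sub>R g x) = integral A g"
proof -
  have "integral S (\<lambda>x. indicator A x *\<^sub>R g x) = integral S (\<lambda>x. if x \<in> A then g x else 0)"
    by (rule integral_cong) (simp add: indicator_def)
  also have "\<dots> = integral A g"
    using assms by (simp add: Henstock_Kurzweil_Integration.integral_restrict_Int Int_absorb2)
  finally show ?thesis .
qed

lemma integral_Ioc_eq_Icc: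
  fixes g :: "real \<Rightarrow> 'b::banach"
  shows "integral {a<..b} g = integral {a..b} g"
  by (rule integral_subset_negligible) (auto intro: negligible_subset[of "{a}"])

lemma Fubini_absolutely_integrable_on_snd:
  fixes F :: "'a::euclidean_space \<times> 'b::euclidean_space \<Rightarrow> 'c::euclidean_space"
  assumes "F absolutely_integrable_on (A \<times> B)"
  shows "integral (A \<times> B) F = integral B (\<lambda>y. integral A (\<lambda>x. F (x, y)))"
  using Fubini_absolutely_integrable_on(3)[OF absolutely_integrable_on_swap(1)[OF assms]]
    absolutely_integrable_on_swap(2)[OF assms] by simp

text \<open>The slopes \<open>1 / h\<close> and \<open>- 1 / h\<close> turn the integral into a
  difference of averages over windows to the right of \<open>a\<close> and \<open>b\<close>. This is
  used in space for the flux term and in time for the mass.\<close>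

lemma integral_trapezoid_deriv:
  fixes G :: "real \<Rightarrow> 'b::euclidean_space"
  assumes "G integrable_on {x1..x2}" "x1 \<le> a" "a \<le> b" "b + h \<le> x2" "0 < h"
  shows "integral {x1..x2} (\<lambda>x. trapezoid_deriv a b h x *\<^sub>R G x) =
    integral {a..a + h} G /\<^sub>R h - integral {b..b + h} G /\<^sub>R h"
proof -
  have Ioo: "integral {x1..x2} (\<lambda>x. indicator {c<..<c + h} x *\<^sub>R G x) = integral {c..c + h} G"
    "(\<lambda>x. indicator {c<..<c + h} x *\<^sub>R G x) integrable_on {x1..x2}" if "x1 \<le> c" "c + h \<le> x2" for c
  proof -
    have sub: "{c<..<c + h} \<subseteq> {x1..x2}"
      using that by auto
    show "integral {x1..x2} (\<lambda>x. indicator {c<..<c + h} x *\<^sub>R G x) = integral {c..c + h} G"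
      unfolding integral_indicator_scaleR[OF sub] by (rule integral_open_interval_real[symmetric])
    have "G integrable_on {c..c + h}"
      by (rule integrable_on_subinterval[OF assms(1)]) (use that in auto)
    then have "G integrable_on {c<..<c + h}"
      by (rule iffD1[OF integrable_on_Icc_iff_Ioo])
    then have "(\<lambda>x. if x \<in> {c<..<c + h} then G x else 0) integrable_on {x1..x2}"
      using sub integrable_restrict_Int[of "{c<..<c + h}" G "{x1..x2}"]
      by (simp add: Int_absorb2)
    then show "(\<lambda>x. indicator {c<..<c + h} x *\<^sub>R G x) integrable_on {x1..x2}"
      by (rule integrable_eq) (simp add: indicator_def)
  qed
  have "integral {x1..x2} (\<lambda>x. trapezoid_deriv a b h x *\<^sub>R G x) =
      integral {x1..x2} (\<lambda>x. (1 / h) *\<^sub>R (indicator {a<..<a + h} x *\<^sub>R G x - indicator {b<..<b + h} x *\<^sub>R G x))"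
    by (rule integral_cong) (simp add: trapezoid_deriv_def flip: scaleR_diff_left)
  also have "\<dots> = (1 / h) *\<^sub>R (integral {a..a + h} G - integral {b..b + h} G)"
    using assms by (simp add: integral_cmul integral_diff Ioo)
  finally show ?thesis
    by (simp add: inverse_eq_divide scaleR_diff_right)
qed

text \<open>With the time weight fixed, the spatial width tends to zero: the trapezoid tends to the
  indicator of \<open>(a, b]\<close>, and the flux term is a difference of averages of
  \<open>H\<close>, which converge to \<open>H a\<close> and \<open>H b\<close> at Lebesgue points.
  The null set depends on \<open>H\<close> but not on \<open>a\<close> and \<open>b\<close>. The
  condition \<open>0 < s\<close> keeps the support off the initial line.\<close>

lemma weak_solution_slices:
  fixes f :: "real ^ 'd \<Rightarrow> real ^ 'd"
  assumes weak: "weak_solution f u" and t: "0 < s" "s \<le> r" "0 < k" "r + k < T"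
  defines "H \<equiv> (\<lambda>x. integral {0..T} (\<lambda>t. trapezoid s r k t *\<^sub>R f (u x t)))"
  obtains N where "negligible N"
    "\<And>a b. a \<notin> N \<Longrightarrow> b \<notin> N \<Longrightarrow> a \<le> b \<Longrightarrow>
      integral {0..T} (\<lambda>t. trapezoid_deriv s r k t *\<^sub>R integral {a..b} (\<lambda>x. u x t)) + (H a - H b) = 0"
proof -
  have u: "(\<lambda>z. u (fst z) (snd z)) absolutely_integrable_on {x1..x2} \<times> {0..T}"
    and fu: "(\<lambda>z. f (u (fst z) (snd z))) absolutely_integrable_on {x1..x2} \<times> {0..T}" if "x1 \<le> x2" for x1 x2
    using weak t that by (auto simp: weak_solution_def case_prod_unfold)
  have H: "H integrable_on {x1..x2}" for x1 x2
  proof (cases "x1 \<le> x2")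
    case True
    have "(\<lambda>z::real \<times> real. trapezoid s r k (snd z)) \<in> borel_measurable borel"
      using tensor_borel[OF borel_measurable_const[of 1] trapezoid_borel] by simp
    from absolutely_integrable_scaleR_bounded[OF this trapezoid_bound[OF t(3)] rectangle_lebesgue fu[OF True]]
    have "(\<lambda>z. trapezoid s r k (snd z) *\<^sub>R f (u (fst z) (snd z))) absolutely_integrable_on {x1..x2} \<times> {0..T}" .
    from Fubini_absolutely_integrable_on(2)[OF this] show ?thesis
      by (simp add: H_def absolutely_integrable_on_def)
  qed (simp add: integrable_on_empty)
  then obtain N where N: "negligible N" and leb: "\<And>x e. x \<notin> N \<Longrightarrow> 0 < e \<Longrightarrow>
      \<exists>d>0. \<forall>h. 0 < h \<and> h < d \<longrightarrow> norm (integral {x..x + h} H /\<^sub>R h - H x) < e"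
    using integrable_ccontinuous_explicit[of H] by auto
  show thesis
  proof (rule that[OF N])
    fix a b assume ab: "a \<notin> N" "b \<notin> N" "a \<le> b"
    define h where "h = (\<lambda>j. inverse (real (Suc j)))"
    have h: "0 < h j" "h j \<le> 1" "h \<longlonglongrightarrow> 0" for j
      using LIMSEQ_inverse_real_of_nat by (auto simp: h_def inverse_le_1_iff)
    \<comment> \<open>\<open>N\<close> is the exceptional set of Lebesgue's differentiation theorem for \<open>H\<close>.\<close>
    have avg: "(\<lambda>j. integral {x..x + h j} H /\<^sub>R h j) \<longlonglongrightarrow> H x" if "x \<notin> N" for x
    proof (rule LIMSEQ_I)
      fix e :: real assume "0 < e"
      then obtain d where d: "d > 0" "\<And>h. 0 < h \<Longrightarrow> h < d \<Longrightarrow> norm (integral {x..x + h} H /\<^sub>R h - H x) < e"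
        using leb[OF \<open>x \<notin> N\<close>] by blast
      obtain m where "\<And>j. j \<ge> m \<Longrightarrow> h j < d"
        using order_tendstoD(2)[OF h(3) d(1)] by (auto simp: eventually_sequentially)
      then show "\<exists>m. \<forall>j\<ge>m. norm (integral {x..x + h j} H /\<^sub>R h j - H x) < e"
        using d(2) h(1) by blast
    qed
    \<comment> \<open>The widths are at most \<open>1\<close>, so margins of \<open>1\<close> on the
      left and \<open>2\<close> on the right keep all trapezoids strictly inside one
      rectangle.\<close>
    define x1 where "x1 = a - 1"
    define x2 where "x2 = b + 2"
    have x: "x1 \<le> x2" "x1 < a" "b + h j < x2" for j
      using h(2)[of j] ab by (auto simp: x1_def x2_def)
    let ?Q = "{x1..x2} \<times> {0..T}"
    let ?S = "trapezoid s r k" and ?S' = "trapezoid_deriv s r k"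
    define I where "I = (\<lambda>j. integral ?Q (\<lambda>z. (trapezoid a b (h j) (fst z) * ?S' (snd z)) *\<^sub>R u (fst z) (snd z)))"
    define J where "J = (\<lambda>j. integral ?Q (\<lambda>z. (trapezoid_deriv a b (h j) (fst z) * ?S (snd z)) *\<^sub>R f (u (fst z) (snd z))))"
    have IJ: "I j + J j = 0" for j
      unfolding I_def J_def by (rule weak_solution_trapezoid[OF weak]) (use x h ab t in auto)
    have bd: "\<bar>trapezoid a b (h j) (fst z) * ?S' (snd z)\<bar> \<le> 1 * (1 / k)" for j z
      by (intro tensor_bound trapezoid_bound trapezoid_deriv_bound h t)
    have bd': "\<bar>trapezoid_deriv a b (h j) (fst z) * ?S (snd z)\<bar> \<le> 1 / h j * 1" for j z
      by (intro tensor_bound trapezoid_bound trapezoid_deriv_bound h t)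
    have bd0: "\<bar>indicator {a<..b} (fst z) * ?S' (snd z)\<bar> \<le> 1 * (1 / k)" for z
      by (intro tensor_bound trapezoid_deriv_bound t) (simp add: indicator_def)
    have "I \<longlonglongrightarrow> integral ?Q (\<lambda>z. (indicator {a<..b} (fst z) * ?S' (snd z)) *\<^sub>R u (fst z) (snd z))"
      unfolding I_def
      by (rule scaleR_dominated_convergence[where f="\<lambda>j z. trapezoid a b (h j) (fst z) * ?S' (snd z)",
          OF _ bd _ rectangle_lebesgue u[OF x(1)]])
        (auto intro!: tensor_borel trapezoid_borel trapezoid_deriv_borel tendsto_mult trapezoid_tendsto ab h)
    also have "integral ?Q (\<lambda>z. (indicator {a<..b} (fst z) * ?S' (snd z)) *\<^sub>R u (fst z) (snd z)) =
        integral {0..T} (\<lambda>t. integral {x1..x2} (\<lambda>x. (indicator {a<..b} x * ?S' t) *\<^sub>R u x t))"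
    proof -
      have "(\<lambda>z. (indicator {a<..b} (fst z) * ?S' (snd z)) *\<^sub>R u (fst z) (snd z)) absolutely_integrable_on ?Q"
        by (rule absolutely_integrable_scaleR_bounded[where f="\<lambda>z. indicator {a<..b} (fst z) * ?S' (snd z)",
              OF _ bd0 rectangle_lebesgue u[OF x(1)]])
          (auto intro!: tensor_borel trapezoid_deriv_borel)
      from Fubini_absolutely_integrable_on_snd[OF this] show ?thesis
        by simp
    qed
    also have "\<dots> = integral {0..T} (\<lambda>t. ?S' t *\<^sub>R integral {a..b} (\<lambda>x. u x t))"
    proof (rule integral_cong)
      fix t
      have sub: "{a<..b} \<subseteq> {x1..x2}"
        by (auto simp: x1_def x2_def)
      have "integral {x1..x2} (\<lambda>x. (indicator {a<..b} x * ?S' t) *\<^sub>R u x t) =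
          integral {x1..x2} (\<lambda>x. indicator {a<..b} x *\<^sub>R (?S' t *\<^sub>R u x t))"
        by simp
      also have "\<dots> = ?S' t *\<^sub>R integral {a..b} (\<lambda>x. u x t)"
        unfolding integral_indicator_scaleR[OF sub] integral_Ioc_eq_Icc by simp
      finally show "integral {x1..x2} (\<lambda>x. (indicator {a<..b} x * ?S' t) *\<^sub>R u x t) =
          ?S' t *\<^sub>R integral {a..b} (\<lambda>x. u x t)" .
    qed
    finally have I: "I \<longlonglongrightarrow> integral {0..T} (\<lambda>t. ?S' t *\<^sub>R integral {a..b} (\<lambda>x. u x t))" .
    have "J j = integral {a..a + h j} H /\<^sub>R h j - integral {b..b + h j} H /\<^sub>R h j" for j
    proof -
      have "(\<lambda>z. (trapezoid_deriv a b (h j) (fst z) * ?S (snd z)) *\<^sub>R f (u (fst z) (snd z))) absolutely_integrable_on ?Q"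
        by (rule absolutely_integrable_scaleR_bounded[where f="\<lambda>z. trapezoid_deriv a b (h j) (fst z) * ?S (snd z)",
              OF _ bd' rectangle_lebesgue fu[OF x(1)]])
          (intro tensor_borel trapezoid_deriv_borel trapezoid_borel)
      \<comment> \<open>For the flux term the time integral is taken inside; the spatial weight is
        constant there and comes out, leaving \<open>H x\<close>.\<close>
      from Fubini_absolutely_integrable_on(3)[OF this]
      have "J j = integral {x1..x2} (\<lambda>x. integral {0..T} (\<lambda>t. trapezoid_deriv a b (h j) x *\<^sub>R (?S t *\<^sub>R f (u x t))))"
        by (simp add: J_def)
      also have "\<dots> = integral {x1..x2} (\<lambda>x. trapezoid_deriv a b (h j) x *\<^sub>R H x)"
        unfolding H_def integral_cmul ..
      also have "\<dots> = integral {a..a + h j} H /\<^sub>R h j - integral {b..b + h j} H /\<^sub>R h j"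
        by (rule integral_trapezoid_deriv[OF H]) (use x(2) x(3)[of j] ab h(1)[of j] in simp_all)
      finally show ?thesis .
    qed
    then have "J \<longlonglongrightarrow> H a - H b"
      using tendsto_diff[OF avg[OF ab(1)] avg[OF ab(2)]] by presburger
    from tendsto_add[OF I this] show "integral {0..T} (\<lambda>t. ?S' t *\<^sub>R integral {a..b} (\<lambda>x. u x t)) + (H a - H b) = 0"
      unfolding IJ by (rule LIMSEQ_unique[OF tendsto_const, symmetric])
  qed
qed

section \<open>Letting the temporal ramps shrink\<close>

lemma average_tendsto:
  fixes m :: "real \<Rightarrow> 'b::euclidean_space"
  assumes cont: "continuous_on {s..s + 1} m" and h: "\<And>j. 0 < h j" "\<And>j. h j \<le> 1" "h \<longlonglongrightarrow> 0"
  shows "(\<lambda>j. integral {s..s + h j} m /\<^sub>R h j) \<longlonglongrightarrow> m s"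
proof -
  \<comment> \<open>At the left endpoint of \<open>[s, s + 1]\<close> this is the one-sided
    derivative of the indefinite integral, so only values of \<open>m\<close> to the right of
    \<open>s\<close> enter.\<close>
  have "((\<lambda>t. integral {s..t} m) has_derivative (\<lambda>x. x *\<^sub>R m s)) (at s within {s..s + 1})"
    using integral_has_vector_derivative[OF cont, of s] by (simp add: has_vector_derivative_def)
  then have lim: "((\<lambda>t. (1 / norm (t - s)) *\<^sub>R (integral {s..t} m - (integral {s..s} m + (t - s) *\<^sub>R m s))) \<longlongrightarrow> 0)
      (at s within {s..s + 1})"
    by (simp only: has_derivative_within)
  have "(\<lambda>j. s + h j) \<longlonglongrightarrow> s + 0"
    by (intro tendsto_add tendsto_const h)
  moreover have "s + h j \<in> {s..s + 1}" "s + h j \<noteq> s" for j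
    using h(1)[of j] h(2)[of j] by auto
  ultimately have "filterlim (\<lambda>j. s + h j) (at s within {s..s + 1}) sequentially"
    by (auto simp: filterlim_at)
  from filterlim_compose[OF lim this]
  have lim': "(\<lambda>j. (1 / norm (h j)) *\<^sub>R (integral {s..s + h j} m - h j *\<^sub>R m s)) \<longlonglongrightarrow> 0"
    by simp
  have "(1 / norm (h j)) *\<^sub>R (integral {s..s + h j} m - h j *\<^sub>R m s) = integral {s..s + h j} m /\<^sub>R h j - m s" for j
    using h(1)[of j] by (simp add: scaleR_diff_right inverse_eq_divide)
  with lim' show ?thesis
    by (simp add: LIM_zero_cancel)
qed

text \<open>Time ramps of width \<open>1 / (j + 1)\<close> are used, and the countably many null
  sets are united. Averages of the continuous mass converge to its values at \<open>s\<close> and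
  \<open>r\<close>; integrability of the two flux sections supplies the majorant for the flux terms.
  For now \<open>s\<close> and \<open>r\<close> are arbitrary but fixed, and \<open>N\<close> may
  depend on them.\<close>

lemma weak_solution_rational_balance:
  fixes f :: "real ^ 'd \<Rightarrow> real ^ 'd"
  assumes weak: "weak_solution f u"
    and mass: "\<And>a b. a \<le> b \<Longrightarrow> continuous_on {0..} (\<lambda>t. integral {a..b} (\<lambda>x. u x t))"
    and t: "0 < s" "s \<le> r"
  obtains N where "negligible N"
    "\<And>a b. a \<notin> N \<Longrightarrow> b \<notin> N \<Longrightarrow> a \<le> b \<Longrightarrow>
      (\<lambda>t. f (u a t)) absolutely_integrable_on {0..r + 2} \<Longrightarrow>
      (\<lambda>t. f (u b t)) absolutely_integrable_on {0..r + 2} \<Longrightarrow>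
      integral {a..b} (\<lambda>x. u x s) - integral {a..b} (\<lambda>x. u x r) +
        (integral {s..r} (\<lambda>t. f (u a t)) - integral {s..r} (\<lambda>t. f (u b t))) = 0"
proof -
  define h where "h = (\<lambda>j. inverse (real (Suc j)))"
  have h: "0 < h j" "h j \<le> 1" "h \<longlonglongrightarrow> 0" for j
    using LIMSEQ_inverse_real_of_nat by (auto simp: h_def inverse_le_1_iff)
  \<comment> \<open>Since \<open>h j \<le> 1\<close>, the final time \<open>r + 2\<close> lies
    beyond \<open>r + h j\<close> for every \<open>j\<close>.\<close>
  define H where "H = (\<lambda>j x. integral {0..r + 2} (\<lambda>t. trapezoid s r (h j) t *\<^sub>R f (u x t)))"
  define P where "P = (\<lambda>j N. negligible N \<and> (\<forall>a b. a \<notin> N \<longrightarrow> b \<notin> N \<longrightarrow> a \<le> b \<longrightarrow>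
      integral {0..r + 2} (\<lambda>t. trapezoid_deriv s r (h j) t *\<^sub>R integral {a..b} (\<lambda>x. u x t)) + (H j a - H j b) = 0))"
  have "\<exists>N. P j N" for j
  proof -
    have "r + h j < r + 2"
      using h(2)[of j] by simp
    then show ?thesis
      unfolding P_def H_def
      by (rule weak_solution_slices[OF weak t h(1)]) (rule exI, rule conjI, assumption, blast)
  qed
  then obtain M where "\<And>j. P j (M j)"
    using choice[of P] by blast
  then have M: "negligible (M j)"
    "\<And>a b. a \<notin> M j \<Longrightarrow> b \<notin> M j \<Longrightarrow> a \<le> b \<Longrightarrow>
      integral {0..r + 2} (\<lambda>t. trapezoid_deriv s r (h j) t *\<^sub>R integral {a..b} (\<lambda>x. u x t)) + (H j a - H j b) = 0" for j
    unfolding P_def by blast+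
  show thesis
  proof (rule that[of "\<Union>j. M j"])
    show "negligible (\<Union>j. M j)"
      using M(1) by (intro negligible_countable_Union) auto
    fix a b
    assume ab: "a \<notin> (\<Union>j. M j)" "b \<notin> (\<Union>j. M j)" "a \<le> b"
      and fa: "(\<lambda>t. f (u a t)) absolutely_integrable_on {0..r + 2}"
      and fb: "(\<lambda>t. f (u b t)) absolutely_integrable_on {0..r + 2}"
    let ?m = "\<lambda>t. integral {a..b} (\<lambda>x. u x t)"
    have cont: "continuous_on {c..d} ?m" if "0 \<le> c" for c d
      by (rule continuous_on_subset[OF mass[OF ab(3)]]) (use that in auto)
    have "?m integrable_on {0..r + 2}"
      by (rule integrable_continuous_real[OF cont]) simp
    then have eq: "integral {0..r + 2} (\<lambda>t. trapezoid_deriv s r (h j) t *\<^sub>R ?m t) =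
        integral {s..s + h j} ?m /\<^sub>R h j - integral {r..r + h j} ?m /\<^sub>R h j" for j
      by (rule integral_trapezoid_deriv) (use h(1,2)[of j] t in auto)
    have lim_m: "(\<lambda>j. integral {0..r + 2} (\<lambda>t. trapezoid_deriv s r (h j) t *\<^sub>R ?m t)) \<longlonglongrightarrow> ?m s - ?m r"
      unfolding eq by (intro tendsto_diff average_tendsto cont h) (use t in auto)
    have lim_H: "(\<lambda>j. H j x) \<longlonglongrightarrow> integral {s..r} (\<lambda>t. f (u x t))"
      if "(\<lambda>t. f (u x t)) absolutely_integrable_on {0..r + 2}" for x
    proof -
      have "(\<lambda>j. H j x) \<longlonglongrightarrow> integral {0..r + 2} (\<lambda>t. indicator {s<..r} t *\<^sub>R f (u x t))"
        unfolding H_def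
        by (rule scaleR_dominated_convergence[where f="\<lambda>j. trapezoid s r (h j)", OF trapezoid_borel
              trapezoid_bound[OF h(1)] trapezoid_tendsto[OF t(2) h(1,3)] _ that]) simp
      moreover have "{s<..r} \<subseteq> {0..r + 2}"
        using t by auto
      ultimately show ?thesis
        by (simp only: integral_indicator_scaleR integral_Ioc_eq_Icc)
    qed
    have lim: "(\<lambda>j. integral {0..r + 2} (\<lambda>t. trapezoid_deriv s r (h j) t *\<^sub>R ?m t) + (H j a - H j b)) \<longlonglongrightarrow>
        ?m s - ?m r + (integral {s..r} (\<lambda>t. f (u a t)) - integral {s..r} (\<lambda>t. f (u b t)))"
      by (intro tendsto_add tendsto_diff lim_m lim_H fa fb)
    have zero: "integral {0..r + 2} (\<lambda>t. trapezoid_deriv s r (h j) t *\<^sub>R ?m t) + (H j a - H j b) = 0" for j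
      by (rule M(2)) (use ab in auto)
    show "?m s - ?m r + (integral {s..r} (\<lambda>t. f (u a t)) - integral {s..r} (\<lambda>t. f (u b t))) = 0"
      using lim unfolding zero by (rule LIMSEQ_unique[OF tendsto_const, symmetric])
  qed
qed

section \<open>From rational times to all times\<close>

lemma rational_sequence_from_above:
  obtains q where "\<And>j::nat. q j \<in> \<rat>" "\<And>j. t < q j" "\<And>j. q j < t + 1" "q \<longlonglongrightarrow> (t::real)"
proof -
  define P where "P = (\<lambda>(j::nat) q. q \<in> \<rat> \<and> t < q \<and> q < t + inverse (real (Suc j)))"
  have "\<exists>q. P j q" for j
    using Rats_dense_in_real[of t "t + inverse (real (Suc j))"] by (auto simp: P_def)
  then obtain q where "\<And>j. P j (q j)"
    using choice[of P] by blast
  then have q: "q j \<in> \<rat>" "t < q j" "q j < t + inverse (real (Suc j))" for j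
    by (simp_all add: P_def)
  show thesis
  proof
    show "q j \<in> \<rat>" "t < q j" for j
      by (fact q)+
    have "inverse (real (Suc j)) \<le> 1" for j
      by (simp add: inverse_le_1_iff)
    then show "q j < t + 1" for j
      using q(3)[of j] add_left_mono order_less_le_trans by blast
    have "(\<lambda>j. t + inverse (real (Suc j))) \<longlonglongrightarrow> t + 0"
      by (rule tendsto_add[OF tendsto_const LIMSEQ_inverse_real_of_nat])
    then have lim: "(\<lambda>j. t + inverse (real (Suc j))) \<longlonglongrightarrow> t"
      by simp
    show "q \<longlonglongrightarrow> t"
      by (rule tendsto_sandwich[OF always_eventually always_eventually tendsto_const lim])
        (intro allI less_imp_le q)+
  qed
qed

text \<open>Fubini's theorem on \<open>[-n, n] \<times> [0, n]\<close> gives a null set for each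
  \<open>n\<close>; their union serves all \<open>x\<close> and all \<open>T\<close>.\<close>

lemma weak_solution_flux_sections:
  fixes f :: "real ^ 'd \<Rightarrow> real ^ 'd"
  assumes weak: "weak_solution f u"
  obtains N where "negligible N"
    "\<And>x T. x \<notin> N \<Longrightarrow> (\<lambda>t. f (u x t)) absolutely_integrable_on {0..T}"
proof -
  define N where "N = (\<lambda>n::nat. {x \<in> {- real n..real n}. \<not> (\<lambda>t. f (u x t)) absolutely_integrable_on {0..real n}})"
  show thesis
  proof (rule that[of "\<Union>n. N n"])
    have "negligible (N n)" for n
    proof -
      have "(\<lambda>(x, t). f (u x t)) absolutely_integrable_on {- real n..real n} \<times> {0..real n}"
        using weak unfolding weak_solution_def by simp
      from Fubini_absolutely_integrable_on(1)[OF this] show ?thesis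
        by (simp add: N_def)
    qed
    then show "negligible (\<Union>n. N n)"
      by (intro negligible_countable_Union) auto
    fix x T assume x: "x \<notin> (\<Union>n. N n)"
    obtain n where n: "max \<bar>x\<bar> T \<le> real n"
      using real_arch_simple by blast
    have "x \<in> {- real n..real n}"
      using n by auto
    then have "(\<lambda>t. f (u x t)) absolutely_integrable_on {0..real n}"
      using x by (auto simp: N_def)
    then show "(\<lambda>t. f (u x t)) absolutely_integrable_on {0..T}"
      by (rule absolutely_integrable_on_subinterval) (use n in auto)
  qed
qed

text \<open>One null set collects the exceptional sets of all rational pairs and that of the flux
  sections. For fixed \<open>a\<close> and \<open>b\<close> outside it, both sides of the balance
  law are continuous in time, so the law extends from positive rational times to all times,
  including \<open>0\<close>.\<close>

lemma weak_solution_balance: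
  fixes f :: "real ^ 'd \<Rightarrow> real ^ 'd"
  assumes weak: "weak_solution f u"
    and mass: "\<And>a b. a \<le> b \<Longrightarrow> continuous_on {0..} (\<lambda>t. integral {a..b} (\<lambda>x. u x t))"
  obtains N where "negligible N"
    "\<And>x T. x \<notin> N \<Longrightarrow> (\<lambda>t. f (u x t)) absolutely_integrable_on {0..T}"
    "\<And>a b t1 t2. a \<notin> N \<Longrightarrow> b \<notin> N \<Longrightarrow> a \<le> b \<Longrightarrow> 0 \<le> t1 \<Longrightarrow> t1 \<le> t2 \<Longrightarrow>
      integral {a..b} (\<lambda>x. u x t2) - integral {a..b} (\<lambda>x. u x t1) =
        integral {t1..t2} (\<lambda>t. f (u a t)) - integral {t1..t2} (\<lambda>t. f (u b t))"
proof -
  obtain N0 where N0: "negligible N0"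
    and sec: "\<And>x T. x \<notin> N0 \<Longrightarrow> (\<lambda>t. f (u x t)) absolutely_integrable_on {0..T}"
    by (rule weak_solution_flux_sections[OF weak]) blast
  \<comment> \<open>The conditions on \<open>s\<close> and \<open>r\<close> stand inside
    \<open>P\<close> so that every pair has a witness, the empty set when they fail; choice then
    applies without restriction.\<close>
  define P where "P = (\<lambda>(s, r) N. negligible N \<and> (\<forall>a b. a \<notin> N \<longrightarrow> b \<notin> N \<longrightarrow> a \<le> b \<longrightarrow>
      (\<lambda>t. f (u a t)) absolutely_integrable_on {0..r + 2} \<longrightarrow>
      (\<lambda>t. f (u b t)) absolutely_integrable_on {0..r + 2} \<longrightarrow>
      0 < s \<longrightarrow> s \<le> r \<longrightarrow>
      integral {a..b} (\<lambda>x. u x s) - integral {a..b} (\<lambda>x. u x r) +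
        (integral {s..r} (\<lambda>t. f (u a t)) - integral {s..r} (\<lambda>t. f (u b t))) = 0))"
  have "\<exists>N. P p N" for p
  proof (cases p)
    case (Pair s r)
    show ?thesis
    proof (cases "0 < s \<and> s \<le> r")
      case True
      then have sr: "0 < s" "s \<le> r"
        by auto
      show ?thesis
        unfolding Pair P_def prod.case
        by (rule weak_solution_rational_balance[OF weak mass sr], assumption) (rule exI, rule conjI, assumption, blast)
    next
      case False
      then have "P p {}"
        by (auto simp: Pair P_def)
      then show ?thesis ..
    qed
  qed
  then obtain M where M: "\<And>p. P p (M p)"
    using choice[of P] by blast
  have neg: "negligible (M p)" for p
    using M[of p] by (cases p) (simp add: P_def)
  define N where "N = N0 \<union> (\<Union>p\<in>\<rat> \<times> \<rat>. M p)"
  show thesis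
  proof (rule that[of N])
    have "negligible (\<Union>p\<in>\<rat> \<times> \<rat>. M p)"
    proof (rule negligible_countable_Union)
      show "countable (M ` (\<rat> \<times> \<rat>))"
        by (intro countable_image countable_SIGMA countable_rat)
    qed (use neg in blast)
    then show "negligible N"
      using N0 by (simp add: N_def)
    show N_sec: "(\<lambda>t. f (u x t)) absolutely_integrable_on {0..T}" if "x \<notin> N" for x T
      using sec that by (simp add: N_def)
    fix a b t1 t2 :: real
    assume ab: "a \<notin> N" "b \<notin> N" "a \<le> b" and t: "0 \<le> t1" "t1 \<le> t2"
    define F where "F = (\<lambda>t. f (u a t) - f (u b t))"
    have F: "F absolutely_integrable_on {0..T}" for T
      unfolding F_def by (intro set_integral_diff N_sec ab)
    have F_int: "F integrable_on {c..d}" if "0 \<le> c" for c d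
      by (rule integrable_on_subinterval[OF set_lebesgue_integral_eq_integral(1)[OF F[of d]]]) (use that in auto)
    \<comment> \<open>The balance law between two times says that the mass minus the accumulated net
      flux \<open>F\<close> takes the same value at both.\<close>
    define \<Psi> where "\<Psi> = (\<lambda>t. integral {a..b} (\<lambda>x. u x t) - integral {0..t} F)"
    have F_eq: "integral {c..d} F = integral {c..d} (\<lambda>t. f (u a t)) - integral {c..d} (\<lambda>t. f (u b t))"
      if "0 \<le> c" for c d
    proof -
      have "(\<lambda>t. f (u x t)) integrable_on {c..d}" if "x \<notin> N" for x
        by (rule integrable_on_subinterval[OF set_lebesgue_integral_eq_integral(1)[OF N_sec[OF that, of d]]])
          (use \<open>0 \<le> c\<close> in auto)
      then show ?thesis
        unfolding F_def using ab by (intro integral_diff) auto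
    qed
    have comb: "integral {0..d} F = integral {0..c} F + integral {c..d} F" if "0 \<le> c" "c \<le> d" for c d
      using Henstock_Kurzweil_Integration.integral_combine[OF that F_int[of 0 d]] by simp
    have \<Psi>_rat: "\<Psi> s = \<Psi> r" if "s \<in> \<rat>" "r \<in> \<rat>" "0 < s" "s \<le> r" for s r
    proof -
      have "a \<notin> M (s, r)" "b \<notin> M (s, r)"
        using ab that unfolding N_def by blast+
      then have "integral {a..b} (\<lambda>x. u x s) - integral {a..b} (\<lambda>x. u x r) +
          (integral {s..r} (\<lambda>t. f (u a t)) - integral {s..r} (\<lambda>t. f (u b t))) = 0"
        using M[of "(s, r)"] N_sec[OF ab(1)] N_sec[OF ab(2)] ab(3) that(3,4)
        unfolding P_def prod.case by blast
      then have "integral {a..b} (\<lambda>x. u x s) - integral {a..b} (\<lambda>x. u x r) + integral {s..r} F = 0"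
        using that by (subst F_eq) simp_all
      then have "integral {a..b} (\<lambda>x. u x s) = integral {a..b} (\<lambda>x. u x r) - integral {s..r} F"
        by (simp add: algebra_simps)
      moreover have "integral {0..r} F = integral {0..s} F + integral {s..r} F"
        using that by (intro comb) auto
      ultimately show ?thesis
        by (simp add: \<Psi>_def)
    qed
    have \<Psi>_cont: "continuous_on {0..t2 + 1} \<Psi>"
      unfolding \<Psi>_def
      by (intro continuous_on_diff indefinite_integral_continuous_1 F_int
          continuous_on_subset[OF mass[OF ab(3)]]) auto
    \<comment> \<open>Approximation from above yields positive rationals even when
      \<open>t1 = 0\<close>, and the bound by \<open>t1 + 1\<close> keeps them in the interval on
      which \<open>\<Psi>\<close> is known to be continuous.\<close>
    obtain p where p: "\<And>j::nat. p j \<in> \<rat>" "\<And>j. t1 < p j" "\<And>j. p j < t1 + 1" "p \<longlonglongrightarrow> t1"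
      by (rule rational_sequence_from_above[of t1]) blast
    obtain q where q: "\<And>j::nat. q j \<in> \<rat>" "\<And>j. t2 < q j" "\<And>j. q j < t2 + 1" "q \<longlonglongrightarrow> t2"
      by (rule rational_sequence_from_above[of t2]) blast
    have p_in: "p j \<in> {0..t2 + 1}" and q_in: "q j \<in> {0..t2 + 1}" for j
      using p(2,3)[of j] q(2,3)[of j] t by simp_all
    have lim_p: "(\<lambda>j. \<Psi> (p j)) \<longlonglongrightarrow> \<Psi> t1"
      by (rule continuous_on_tendsto_compose[OF \<Psi>_cont p(4)])
        (use t p_in in auto)
    have lim_q: "(\<lambda>j. \<Psi> (q j)) \<longlonglongrightarrow> \<Psi> t2"
      by (rule continuous_on_tendsto_compose[OF \<Psi>_cont q(4)])
        (use t q_in in auto)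
    \<comment> \<open>The two sequences are chosen independently, so \<open>p j\<close> and
      \<open>q j\<close> may come in either order.\<close>
    have pq: "\<Psi> (p j) = \<Psi> (q j)" for j
    proof -
      have "0 < p j" "0 < q j"
        using p(2)[of j] q(2)[of j] t by auto
      then show ?thesis
        using \<Psi>_rat[OF p(1) q(1), of j j] \<Psi>_rat[OF q(1) p(1), of j j] by (metis linear)
    qed
    have "\<Psi> t1 = \<Psi> t2"
      by (rule LIMSEQ_unique[OF lim_p[unfolded pq] lim_q])
    then have "integral {a..b} (\<lambda>x. u x t2) - integral {a..b} (\<lambda>x. u x t1) = integral {t1..t2} F"
      using comb[OF t] by (simp add: \<Psi>_def algebra_simps)
    then show "integral {a..b} (\<lambda>x. u x t2) - integral {a..b} (\<lambda>x. u x t1) =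
        integral {t1..t2} (\<lambda>t. f (u a t)) - integral {t1..t2} (\<lambda>t. f (u b t))"
      using F_eq[OF t(1), of t2] by simp
  qed
qed

section \<open>The balance law\<close>

text \<open>A bounded change of \<open>u\<close> on a single line \<open>x = c\<close> preserves all
  hypotheses, so the flux integral can be identified only for almost every \<open>x\<close>. Hence
  \<open>g\<close> is a Lipschitz representative that agrees with the integral off a null set common
  to all times, and the balance law is stated for \<open>g\<close>.\<close>

theorem theorem2p2:
  fixes f :: "real ^ 'd \<Rightarrow> real ^ 'd"
    and u :: "real \<Rightarrow> real \<Rightarrow> real ^ 'd"
    and u0 :: "real \<Rightarrow> real ^ 'd"
  assumes weak: "weak_solution f u"
    and initial: "AE x in lebesgue. u x 0 = u0 x"
    and u0_L1: "integrable lebesgue u0"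
    and u0_Linf: "\<exists>C. AE x in lebesgue. norm (u0 x) \<le> C"
    and a: "locally_bounded u"
    and b: "\<And>x1 x2. x1 \<le> x2 \<Longrightarrow>
              (\<forall>t\<ge>0. (\<lambda>x. u x t) absolutely_integrable_on {x1..x2}) \<and>
              continuous_on {0..} (\<lambda>t. integral {x1..x2} (\<lambda>x. u x t))"
  shows "\<exists>N. negligible N \<and>
    (\<forall>t1 t2. 0 \<le> t1 \<longrightarrow> t1 \<le> t2 \<longrightarrow>
      (\<exists>g.
        (\<forall>x. x \<notin> N \<longrightarrow>
           (\<lambda>t. f (u x t)) absolutely_integrable_on {t1..t2} \<and>
           g x = integral {t1..t2} (\<lambda>t. f (u x t))) \<and>
        locally_lipschitz g \<and>
        (\<forall>x1 x2. x1 \<le> x2 \<longrightarrow>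
           integral {x1..x2} (\<lambda>x. u x t2) - integral {x1..x2} (\<lambda>x. u x t1) = - (g x2 - g x1))))"
proof -
  have mass: "\<And>a b. a \<le> b \<Longrightarrow> continuous_on {0..} (\<lambda>t. integral {a..b} (\<lambda>x. u x t))"
    using b by blast
  show ?thesis
  proof (rule weak_solution_balance[OF weak mass])
    fix N
    assume N: "negligible N"
      and sec: "\<And>x T. x \<notin> N \<Longrightarrow> (\<lambda>t. f (u x t)) absolutely_integrable_on {0..T}"
      and bal: "\<And>a b t1 t2. a \<notin> N \<Longrightarrow> b \<notin> N \<Longrightarrow> a \<le> b \<Longrightarrow> 0 \<le> t1 \<Longrightarrow> t1 \<le> t2 \<Longrightarrow>
        integral {a..b} (\<lambda>x. u x t2) - integral {a..b} (\<lambda>x. u x t1) =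
          integral {t1..t2} (\<lambda>t. f (u a t)) - integral {t1..t2} (\<lambda>t. f (u b t))"
    \<comment> \<open>The base point must be admissible, because the value of the flux integral
      there anchors \<open>g\<close>.\<close>
    obtain x0 where x0: "x0 \<notin> N"
      using N non_negligible_UNIV by (metis UNIV_eq_I)
    show ?thesis
    proof (intro exI[of _ N] conjI N allI impI)
      fix t1 t2 :: real
      assume t: "0 \<le> t1" "t1 \<le> t2"
      define w where "w = (\<lambda>x. u x t2 - u x t1)"
      define H where "H = (\<lambda>x. integral {t1..t2} (\<lambda>t. f (u x t)))"
      \<comment> \<open>Integrals over empty intervals are \<open>0\<close>, so on either side of
        \<open>x0\<close> only one term survives: \<open>V\<close> is the signed primitive of
        \<open>w\<close> vanishing at \<open>x0\<close>.\<close>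
      define V where "V = (\<lambda>x. integral {x0..x} w - integral {x..x0} w)"
      define g where "g = (\<lambda>x. H x0 - V x)"
      have u_int: "(\<lambda>x. u x t) integrable_on {x1..x2}" if "0 \<le> t" for t x1 x2
      proof (cases "x1 \<le> x2")
        case True
        then show ?thesis
          using b[OF True] that set_lebesgue_integral_eq_integral(1) by blast
      qed (simp add: integrable_on_empty)
      have w_int: "w integrable_on {x1..x2}" for x1 x2
        unfolding w_def using t by (intro integrable_diff u_int) auto
      have w_eq: "integral {x1..x2} w = integral {x1..x2} (\<lambda>x. u x t2) - integral {x1..x2} (\<lambda>x. u x t1)" for x1 x2
        unfolding w_def using t by (intro integral_diff u_int) auto
      have comb: "integral {x..z} w = integral {x..y} w + integral {y..z} w" if "x \<le> y" "y \<le> z" for x y z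
        using Henstock_Kurzweil_Integration.integral_combine[OF that w_int] by simp
      have V_diff: "V x2 - V x1 = integral {x1..x2} w" if "x1 \<le> x2" for x1 x2
      proof -
        consider "x0 \<le> x1" | "x1 < x0" "x0 \<le> x2" | "x2 < x0"
          by linarith
        then show ?thesis
        proof cases
          case 1
          then have "integral {x1..x0} w = 0" "integral {x2..x0} w = 0"
            using that by (cases "x1 = x0"; cases "x2 = x0"; simp)+
          then show ?thesis
            using comb[OF 1 that] by (simp add: V_def)
        next
          case 2
          then have "integral {x0..x1} w = 0" "integral {x2..x0} w = 0"
            by (cases "x2 = x0"; simp)+
          then show ?thesis
            using comb[of x1 x0 x2] 2 by (simp add: V_def)
        next
          case 3
          then have "integral {x0..x1} w = 0" "integral {x0..x2} w = 0"
            using that by simp_all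
          then show ?thesis
            using comb[of x1 x2 x0] 3 that by (simp add: V_def algebra_simps)
        qed
      qed
      \<comment> \<open>The balance law between \<open>x0\<close> and \<open>x\<close> reads
        \<open>V x = H x0 - H x\<close>, on either side of \<open>x0\<close>.\<close>
      have g_eq: "g x = H x" if "x \<notin> N" for x
      proof (cases "x0 \<le> x")
        case True
        have "integral {x..x0} w = 0"
          using True by (cases "x = x0") simp_all
        then show ?thesis
          using bal[OF x0 that True t] by (simp add: g_def V_def H_def w_eq)
      next
        case False
        then have "integral {x0..x} w = 0" "x \<le> x0"
          by simp_all
        then show ?thesis
          using bal[OF that x0 _ t] by (simp add: g_def V_def H_def w_eq algebra_simps)
      qed
      have lip: "locally_lipschitz g"
        unfolding locally_lipschitz_def
      proof
        fix x :: real
        \<comment> \<open>Since \<open>w\<close> involves only the times \<open>t1\<close> and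
          \<open>t2\<close>, two compact time slices suffice for the local bound; it makes
          \<open>2 * C\<close> a Lipschitz constant of the primitive.\<close>
        let ?K = "{x - 1..x + 1} \<times> {t1, t2}"
        have "compact ?K" "?K \<subseteq> UNIV \<times> {0..}"
          using t by (auto intro!: compact_Times)
        then have "bounded ((\<lambda>(x, t). u x t) ` ?K)"
          using a unfolding locally_bounded_def by blast
        then obtain C where C: "\<And>y s. y \<in> {x - 1..x + 1} \<Longrightarrow> s \<in> {t1, t2} \<Longrightarrow> norm (u y s) \<le> C"
          unfolding bounded_iff by fastforce
        have C0: "0 \<le> C"
          by (rule order_trans[OF norm_ge_zero C[of x t1]]) simp_all
        have w_le: "norm (w y) \<le> 2 * C" if "y \<in> {x - 1..x + 1}" for y
          unfolding w_def using norm_triangle_ineq4[of "u y t2" "u y t1"] C[OF that, of t1] C[OF that, of t2] by simp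
        have le: "norm (g y - g z) \<le> 2 * C * \<bar>y - z\<bar>"
          if "y \<in> {x - 1..x + 1}" "z \<in> {x - 1..x + 1}" "y \<le> z" for y z
        proof -
          have "norm (g y - g z) = norm (integral {y..z} w)"
            using V_diff[OF that(3)] by (simp add: g_def)
          also have "\<dots> \<le> integral {y..z} (\<lambda>_. 2 * C)"
            by (rule integral_norm_bound_integral[OF w_int]) (use that w_le in auto)
          also have "\<dots> = 2 * C * \<bar>y - z\<bar>"
            using that(3) by (simp add: abs_if)
          finally show ?thesis .
        qed
        have "(2 * C)-lipschitz_on (cball x 1) g"
        proof (rule lipschitz_onI)
          fix y z assume "y \<in> cball x 1" "z \<in> cball x 1"
          then have yz: "y \<in> {x - 1..x + 1}" "z \<in> {x - 1..x + 1}"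
            by (auto simp: dist_real_def)
          show "dist (g y) (g z) \<le> 2 * C * dist y z"
            using le[OF yz] le[OF yz(2,1)] by (cases "y \<le> z") (simp_all add: dist_norm norm_minus_commute)
        qed (use C0 in simp)
        then show "\<exists>e>0. \<exists>L. L-lipschitz_on (cball x e) g"
          using zero_less_one by blast
      qed
      have sec': "(\<lambda>t. f (u x t)) absolutely_integrable_on {t1..t2}" if "x \<notin> N" for x
        by (rule absolutely_integrable_on_subinterval[OF sec[OF that, of t2]]) (use t in auto)
      \<comment> \<open>As \<open>g\<close> is built from a primitive of \<open>w\<close>, the
        equality holds for all endpoints, even those in \<open>N\<close>.\<close>
      have "integral {x1..x2} (\<lambda>x. u x t2) - integral {x1..x2} (\<lambda>x. u x t1) = - (g x2 - g x1)" if "x1 \<le> x2" for x1 x2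
        using V_diff[OF that] by (simp add: g_def w_eq)
      with lip sec' g_eq show "\<exists>g. (\<forall>x. x \<notin> N \<longrightarrow> (\<lambda>t. f (u x t)) absolutely_integrable_on {t1..t2} \<and>
             g x = integral {t1..t2} (\<lambda>t. f (u x t))) \<and> locally_lipschitz g \<and>
          (\<forall>x1 x2. x1 \<le> x2 \<longrightarrow>
             integral {x1..x2} (\<lambda>x. u x t2) - integral {x1..x2} (\<lambda>x. u x t1) = - (g x2 - g x1))"
        unfolding H_def by (intro exI[of _ g]) simp
    qed
  qed
qed

end
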